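(* Let $\mathcal{A}$ be a coquasitriangular Hopf algebra with universal $r$-form $\mathbf{r}$ and antipode $S$, and let $\mathbf{s}:=\bar{\mathbf{r}}_{21}$ be the second universal $r$-form, $\mathbf{s}(a\otimes b)=\bar{\mathbf{r}}(b\otimes a)$. Then the functionals $f_{\mathbf{r}},\bar{f_{\mathbf{r}}},f_{\mathbf{s}},\bar{f_{\mathbf{s}}}$ pairwise commute in the algebra $\mathcal{A}'$, the functional $z:=f_{\mathbf{r}}\ast\bar{f_{\mathbf{s}}}$ belongs to the center of $\mathcal{A}'$, and $g:=f_{\mathbf{r}}\ast f_{\mathbf{s}}$ is a character of $\mathcal{A}$ (that is, $g(ab)=g(a)g(b)$ for all $a,b\in\mathcal{A}$) such that $S^4=\bar g\ast\mathrm{id}\ast g$.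
   Context: All algebras and coalgebras are over a fixed ground field. Sweedler notation $\Delta(a)=a_{(1)}\otimes a_{(2)}$. $\mathcal{A}'$ is the dual algebra of all linear functionals on $\mathcal{A}$ with convolution product $\ast$: $(f\ast h)(a)=f(a_{(1)})h(a_{(2)})$; $\bar f$ denotes the convolution inverse. For functionals $f,h$, $(f\ast\mathrm{id}\ast h)(a)=f(a_{(1)})\,a_{(2)}\,h(a_{(3)})$. A universal $r$-form on $\mathcal{A}$ is a convolution invertible linear functional $\mathbf{r}$ on $\mathcal{A}\otimes\mathcal{A}$ such that for all $a,b,c\in\mathcal{A}$: $\mathbf{r}(c\otimes ab)=\mathbf{r}(c_{(1)}\otimes b)\mathbf{r}(c_{(2)}\otimes a)$; $\mathbf{r}(ab\otimes c)=\mathbf{r}(a\otimes c_{(1)})\mathbf{r}(b\otimes c_{(2)})$; $\mathbf{r}(a_{(1)}\otimes b_{(1)})a_{(2)}b_{(2)}=\mathbf{r}(a_{(2)}\otimes b_{(2)})b_{(1)}a_{(1)}$. A Hopf algebra is coquasitriangular if it is equipped with a universal $r$-form. $\bar{\mathbf{r}}$ is the convolution inverse of $\mathbf{r}$. For any universal $r$-form $\mathbf{t}$ of $\mathcal{A}$ (in particular $\mathbf{t}=\mathbf{r}$ or $\mathbf{t}=\mathbf{s}$), define functionals on $\mathcal{A}$ by $f_{\mathbf{t}}(a)=\mathbf{t}(a_{(1)}\otimes S(a_{(2)}))$ and $\bar{f_{\mathbf{t}}}(a)=\bar{\mathbf{t}}(S(a_{(1)})\otimes a_{(2)})$; it is known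 that $\bar{f_{\mathbf{t}}}$ is the convolution inverse of $f_{\mathbf{t}}$. *)

theory Defs
  imports Complex_Main "HOL-Library.Poly_Mapping"
begin

text \<open>
  The algebra is a type \<open>'a :: ring_1\<close> with a scalar multiplication \<open>s :: 'k :: field \<Rightarrow> 'a \<Rightarrow> 'a\<close>.
  Since the scalar multiplication is a term, the tensor square cannot be a type depending on it;
  it is the set of classes of the free vector space on pairs, \<open>('a \<times> 'a) \<Rightarrow>\<^sub>0 'k\<close>, modulo the
  usual relations.
\<close>

definition free_scale :: "'k::field \<Rightarrow> ('x \<Rightarrow>\<^sub>0 'k) \<Rightarrow> ('x \<Rightarrow>\<^sub>0 'k)" where
  "free_scale c u = Poly_Mapping.map (\<lambda>d. c * d) u"

text \<open>Extension of \<open>\<phi>\<close> from the basis to a linear map into the space with scalar multiplication \<open>t\<close>.\<close>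

definition free_lift ::
  "('k::field \<Rightarrow> 'c \<Rightarrow> 'c) \<Rightarrow> ('x \<Rightarrow> 'c) \<Rightarrow> ('x \<Rightarrow>\<^sub>0 'k) \<Rightarrow> 'c::comm_monoid_add" where
  "free_lift t \<phi> u = (\<Sum>x\<in>Poly_Mapping.keys u. t (Poly_Mapping.lookup u x) (\<phi> x))"

subsection \<open>The tensor square\<close>

definition tensor_relators ::
  "('k::field \<Rightarrow> 'a \<Rightarrow> 'a) \<Rightarrow> (('a::ab_group_add \<times> 'a) \<Rightarrow>\<^sub>0 'k) set" where
  "tensor_relators s =
     {Poly_Mapping.single (x + x', y) 1 - Poly_Mapping.single (x, y) 1
        - Poly_Mapping.single (x', y) 1 | x x' y. True} \<union>
     {Poly_Mapping.single (x, y + y') 1 - Poly_Mapping.single (x, y) 1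
        - Poly_Mapping.single (x, y') 1 | x y y'. True} \<union>
     {Poly_Mapping.single (s c x, y) 1 - Poly_Mapping.single (x, y) c | c x y. True} \<union>
     {Poly_Mapping.single (x, s c y) 1 - Poly_Mapping.single (x, y) c | c x y. True}"

definition tensor_rel ::
  "('k::field \<Rightarrow> 'a \<Rightarrow> 'a) \<Rightarrow> ((('a::ab_group_add \<times> 'a) \<Rightarrow>\<^sub>0 'k) \<times> (('a \<times> 'a) \<Rightarrow>\<^sub>0 'k)) set" where
  "tensor_rel s = {(u, v). u - v \<in> module.span free_scale (tensor_relators s)}"

type_synonym ('a, 'k) tensor2 = "(('a \<times> 'a) \<Rightarrow>\<^sub>0 'k) set"

definition tensor_space ::
  "('k::field \<Rightarrow> 'a::ab_group_add \<Rightarrow> 'a) \<Rightarrow> ('a, 'k) tensor2 set" where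
  "tensor_space s = UNIV // tensor_rel s"

definition tensor_class ::
  "('k::field \<Rightarrow> 'a::ab_group_add \<Rightarrow> 'a) \<Rightarrow> (('a \<times> 'a) \<Rightarrow>\<^sub>0 'k) \<Rightarrow> ('a, 'k) tensor2" where
  "tensor_class s u = tensor_rel s `` {u}"

text \<open>Every use of a representative below is independent of the choice
  (for \<open>tensor_lift\<close>: when \<open>\<phi>\<close> is bilinear, or bilinear modulo the span of the relators if its
  values are then passed to \<open>tensor_class\<close> or \<open>tensor3_class\<close>).\<close>

definition tensor_rep :: "('a, 'k::zero) tensor2 \<Rightarrow> (('a \<times> 'a) \<Rightarrow>\<^sub>0 'k)" where
  "tensor_rep T = (SOME u. u \<in> T)"

definition tensor ::
  "('k::field \<Rightarrow> 'a::ab_group_add \<Rightarrow> 'a) \<Rightarrow> 'a \<Rightarrow> 'a \<Rightarrow> ('a, 'k) tensor2" where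
  "tensor s x y = tensor_class s (Poly_Mapping.single (x, y) 1)"

definition tensor_add ::
  "('k::field \<Rightarrow> 'a::ab_group_add \<Rightarrow> 'a) \<Rightarrow> ('a, 'k) tensor2 \<Rightarrow> ('a, 'k) tensor2 \<Rightarrow> ('a, 'k) tensor2"
where
  "tensor_add s T U = tensor_class s (tensor_rep T + tensor_rep U)"

definition tensor_scale ::
  "('k::field \<Rightarrow> 'a::ab_group_add \<Rightarrow> 'a) \<Rightarrow> 'k \<Rightarrow> ('a, 'k) tensor2 \<Rightarrow> ('a, 'k) tensor2" where
  "tensor_scale s c T = tensor_class s (free_scale c (tensor_rep T))"

text \<open>The linear map on the tensor square induced by a bilinear map \<open>\<phi>\<close> into the space with scalar
  multiplication \<open>t\<close>.  Sweedler notation is rendered by it: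
  \<open>\<phi>(a\<^sub>(\<^sub>1\<^sub>), a\<^sub>(\<^sub>2\<^sub>))\<close> is \<open>tensor_lift t \<phi> (\<Delta> a)\<close>.\<close>

definition tensor_lift ::
  "('k::field \<Rightarrow> 'c \<Rightarrow> 'c) \<Rightarrow> ('a \<Rightarrow> 'a \<Rightarrow> 'c) \<Rightarrow> ('a, 'k) tensor2 \<Rightarrow> 'c::comm_monoid_add" where
  "tensor_lift t \<phi> T = free_lift t (\<lambda>(x, y). \<phi> x y) (tensor_rep T)"

text \<open>The product \<open>(x \<otimes> y) (x' \<otimes> y') = x x' \<otimes> y y'\<close>.\<close>

definition tensor_mult ::
  "('k::field \<Rightarrow> 'a::ring_1 \<Rightarrow> 'a) \<Rightarrow> ('a, 'k) tensor2 \<Rightarrow> ('a, 'k) tensor2 \<Rightarrow> ('a, 'k) tensor2" where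
  "tensor_mult s T U = tensor_class s
     (tensor_lift free_scale (\<lambda>x y. tensor_lift free_scale
        (\<lambda>x' y'. Poly_Mapping.single (x * x', y * y') 1) U) T)"

definition tensor_flip ::
  "('k::field \<Rightarrow> 'a::ab_group_add \<Rightarrow> 'a) \<Rightarrow> ('a, 'k) tensor2 \<Rightarrow> ('a, 'k) tensor2" where
  "tensor_flip s T = tensor_class s
     (tensor_lift free_scale (\<lambda>x y. Poly_Mapping.single (y, x) 1) T)"

subsection \<open>The tensor cube, as needed for coassociativity\<close>

definition tensor3_relators ::
  "('k::field \<Rightarrow> 'a \<Rightarrow> 'a) \<Rightarrow> (('a::ab_group_add \<times> 'a \<times> 'a) \<Rightarrow>\<^sub>0 'k) set" where
  "tensor3_relators s =
     {Poly_Mapping.single (x + x', y, z) 1 - Poly_Mapping.single (x, y, z) 1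
        - Poly_Mapping.single (x', y, z) 1 | x x' y z. True} \<union>
     {Poly_Mapping.single (x, y + y', z) 1 - Poly_Mapping.single (x, y, z) 1
        - Poly_Mapping.single (x, y', z) 1 | x y y' z. True} \<union>
     {Poly_Mapping.single (x, y, z + z') 1 - Poly_Mapping.single (x, y, z) 1
        - Poly_Mapping.single (x, y, z') 1 | x y z z'. True} \<union>
     {Poly_Mapping.single (s c x, y, z) 1 - Poly_Mapping.single (x, y, z) c | c x y z. True} \<union>
     {Poly_Mapping.single (x, s c y, z) 1 - Poly_Mapping.single (x, y, z) c | c x y z. True} \<union>
     {Poly_Mapping.single (x, y, s c z) 1 - Poly_Mapping.single (x, y, z) c | c x y z. True}"

definition tensor3_rel ::
  "('k::field \<Rightarrow> 'a \<Rightarrow> 'a) \<Rightarrow>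
     ((('a::ab_group_add \<times> 'a \<times> 'a) \<Rightarrow>\<^sub>0 'k) \<times> (('a \<times> 'a \<times> 'a) \<Rightarrow>\<^sub>0 'k)) set" where
  "tensor3_rel s = {(u, v). u - v \<in> module.span free_scale (tensor3_relators s)}"

definition tensor3_class ::
  "('k::field \<Rightarrow> 'a::ab_group_add \<Rightarrow> 'a) \<Rightarrow> (('a \<times> 'a \<times> 'a) \<Rightarrow>\<^sub>0 'k) \<Rightarrow>
     (('a \<times> 'a \<times> 'a) \<Rightarrow>\<^sub>0 'k) set" where
  "tensor3_class s u = tensor3_rel s `` {u}"

subsection \<open>Hopf algebras\<close>

locale algebra_over_field = vector_space scale
  for scale :: "'k::field \<Rightarrow> 'a::ring_1 \<Rightarrow> 'a" +
  assumes scale_mult_left: "scale c x * y = scale c (x * y)"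
    and scale_mult_right: "x * scale c y = scale c (x * y)"

text \<open>\<open>coassoc\<close> is \<open>(\<Delta> \<otimes> id) \<circ> \<Delta> = (id \<otimes> \<Delta>) \<circ> \<Delta>\<close>, evaluated in the tensor cube.\<close>

locale bialgebra = algebra_over_field scale
  for scale :: "'k::field \<Rightarrow> 'a::ring_1 \<Rightarrow> 'a" +
  fixes \<Delta> :: "'a \<Rightarrow> ('a, 'k) tensor2"
    and \<epsilon> :: "'a \<Rightarrow> 'k"
  assumes comult_in: "\<Delta> a \<in> tensor_space scale"
    and comult_add: "\<Delta> (a + b) = tensor_add scale (\<Delta> a) (\<Delta> b)"
    and comult_scale: "\<Delta> (scale c a) = tensor_scale scale c (\<Delta> a)"
    and coassoc:
      "tensor3_class scale (tensor_lift free_scale (\<lambda>x y. tensor_lift free_scale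
         (\<lambda>x1 x2. Poly_Mapping.single (x1, x2, y) 1) (\<Delta> x)) (\<Delta> a)) =
       tensor3_class scale (tensor_lift free_scale (\<lambda>x y. tensor_lift free_scale
         (\<lambda>y1 y2. Poly_Mapping.single (x, y1, y2) 1) (\<Delta> y)) (\<Delta> a))"
    and counit_linear: "Vector_Spaces.linear scale (*) \<epsilon>"
    and counit_left: "tensor_lift scale (\<lambda>x y. scale (\<epsilon> x) y) (\<Delta> a) = a"
    and counit_right: "tensor_lift scale (\<lambda>x y. scale (\<epsilon> y) x) (\<Delta> a) = a"
    and comult_mult: "\<Delta> (a * b) = tensor_mult scale (\<Delta> a) (\<Delta> b)"
    and comult_one: "\<Delta> 1 = tensor scale 1 1"
    and counit_mult: "\<epsilon> (a * b) = \<epsilon> a * \<epsilon> b"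
    and counit_one: "\<epsilon> 1 = 1"

locale hopf_algebra = bialgebra scale \<Delta> \<epsilon>
  for scale :: "'k::field \<Rightarrow> 'a::ring_1 \<Rightarrow> 'a"
    and \<Delta> :: "'a \<Rightarrow> ('a, 'k) tensor2"
    and \<epsilon> :: "'a \<Rightarrow> 'k" +
  fixes S :: "'a \<Rightarrow> 'a"
  assumes antipode_linear: "Vector_Spaces.linear scale scale S"
    and antipode_left: "tensor_lift scale (\<lambda>x y. S x * y) (\<Delta> a) = scale (\<epsilon> a) 1"
    and antipode_right: "tensor_lift scale (\<lambda>x y. x * S y) (\<Delta> a) = scale (\<epsilon> a) 1"

subsection \<open>The dual algebra; its unit is \<open>\<epsilon>\<close>\<close>

definition dual_space :: "('k::field \<Rightarrow> 'a::ab_group_add \<Rightarrow> 'a) \<Rightarrow> ('a \<Rightarrow> 'k) set" where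
  "dual_space s = {f. Vector_Spaces.linear s (*) f}"

definition conv :: "('a \<Rightarrow> ('a, 'k::field) tensor2) \<Rightarrow> ('a \<Rightarrow> 'k) \<Rightarrow> ('a \<Rightarrow> 'k) \<Rightarrow> 'a \<Rightarrow> 'k" where
  "conv \<Delta> f h a = tensor_lift (*) (\<lambda>x y. f x * h y) (\<Delta> a)"

definition is_conv_inverse ::
  "('k::field \<Rightarrow> 'a::ab_group_add \<Rightarrow> 'a) \<Rightarrow> ('a \<Rightarrow> ('a, 'k) tensor2) \<Rightarrow> ('a \<Rightarrow> 'k) \<Rightarrow>
     ('a \<Rightarrow> 'k) \<Rightarrow> ('a \<Rightarrow> 'k) \<Rightarrow> bool" where
  "is_conv_inverse s \<Delta> \<epsilon> f h \<longleftrightarrow> h \<in> dual_space s \<and> conv \<Delta> f h = \<epsilon> \<and> conv \<Delta> h f = \<epsilon>"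

definition conv_inv ::
  "('k::field \<Rightarrow> 'a::ab_group_add \<Rightarrow> 'a) \<Rightarrow> ('a \<Rightarrow> ('a, 'k) tensor2) \<Rightarrow> ('a \<Rightarrow> 'k) \<Rightarrow>
     ('a \<Rightarrow> 'k) \<Rightarrow> ('a \<Rightarrow> 'k)" where
  "conv_inv s \<Delta> \<epsilon> f = (THE h. is_conv_inverse s \<Delta> \<epsilon> f h)"

definition dual_center ::
  "('k::field \<Rightarrow> 'a::ab_group_add \<Rightarrow> 'a) \<Rightarrow> ('a \<Rightarrow> ('a, 'k) tensor2) \<Rightarrow> ('a \<Rightarrow> 'k) set" where
  "dual_center s \<Delta> = {z \<in> dual_space s. \<forall>f\<in>dual_space s. conv \<Delta> z f = conv \<Delta> f z}"

definition is_character ::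
  "('k::field \<Rightarrow> 'a::ring_1 \<Rightarrow> 'a) \<Rightarrow> ('a \<Rightarrow> 'k) \<Rightarrow> bool" where
  "is_character s g \<longleftrightarrow> g \<in> dual_space s \<and> (\<forall>a b. g (a * b) = g a * g b)"

text \<open>\<open>(f \<star> id \<star> h)(a) = f(a\<^sub>(\<^sub>1\<^sub>)) a\<^sub>(\<^sub>2\<^sub>) h(a\<^sub>(\<^sub>3\<^sub>))\<close>, with the iterated coproduct
  \<open>(id \<otimes> \<Delta>) \<circ> \<Delta>\<close>.\<close>

definition conv_id_conv ::
  "('k::field \<Rightarrow> 'a::ab_group_add \<Rightarrow> 'a) \<Rightarrow> ('a \<Rightarrow> ('a, 'k) tensor2) \<Rightarrow> ('a \<Rightarrow> 'k) \<Rightarrow>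
     ('a \<Rightarrow> 'k) \<Rightarrow> 'a \<Rightarrow> 'a" where
  "conv_id_conv s \<Delta> f h a =
     tensor_lift s (\<lambda>x y. tensor_lift s (\<lambda>y1 y2. s (f x * h y2) y1) (\<Delta> y)) (\<Delta> a)"

subsection \<open>Functionals on the tensor square\<close>

text \<open>Such a functional only matters on \<open>tensor_space\<close>; its values at other sets are irrelevant.\<close>

definition tensor_functional ::
  "('k::field \<Rightarrow> 'a::ab_group_add \<Rightarrow> 'a) \<Rightarrow> (('a, 'k) tensor2 \<Rightarrow> 'k) \<Rightarrow> bool" where
  "tensor_functional s p \<longleftrightarrow>
     (\<forall>T\<in>tensor_space s. \<forall>U\<in>tensor_space s. p (tensor_add s T U) = p T + p U) \<and>
     (\<forall>c. \<forall>T\<in>tensor_space s. p (tensor_scale s c T) = c * p T)"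

text \<open>Convolution for the tensor product coalgebra:
  \<open>(p \<star> q)(a \<otimes> b) = p(a\<^sub>(\<^sub>1\<^sub>) \<otimes> b\<^sub>(\<^sub>1\<^sub>)) q(a\<^sub>(\<^sub>2\<^sub>) \<otimes> b\<^sub>(\<^sub>2\<^sub>))\<close>.\<close>

definition tensor_conv ::
  "('k::field \<Rightarrow> 'a::ab_group_add \<Rightarrow> 'a) \<Rightarrow> ('a \<Rightarrow> ('a, 'k) tensor2) \<Rightarrow>
     (('a, 'k) tensor2 \<Rightarrow> 'k) \<Rightarrow> (('a, 'k) tensor2 \<Rightarrow> 'k) \<Rightarrow> ('a, 'k) tensor2 \<Rightarrow> 'k" where
  "tensor_conv s \<Delta> p q T =
     tensor_lift (*) (\<lambda>a b. tensor_lift (*) (\<lambda>a1 a2. tensor_lift (*) (\<lambda>b1 b2.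
       p (tensor s a1 b1) * q (tensor s a2 b2)) (\<Delta> b)) (\<Delta> a)) T"

definition is_tensor_conv_inverse ::
  "('k::field \<Rightarrow> 'a::ab_group_add \<Rightarrow> 'a) \<Rightarrow> ('a \<Rightarrow> ('a, 'k) tensor2) \<Rightarrow> ('a \<Rightarrow> 'k) \<Rightarrow>
     (('a, 'k) tensor2 \<Rightarrow> 'k) \<Rightarrow> (('a, 'k) tensor2 \<Rightarrow> 'k) \<Rightarrow> bool" where
  "is_tensor_conv_inverse s \<Delta> \<epsilon> p q \<longleftrightarrow> tensor_functional s q \<and>
     (\<forall>T\<in>tensor_space s.
        tensor_conv s \<Delta> p q T = tensor_lift (*) (\<lambda>a b. \<epsilon> a * \<epsilon> b) T \<and>
        tensor_conv s \<Delta> q p T = tensor_lift (*) (\<lambda>a b. \<epsilon> a * \<epsilon> b) T)"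

text \<open>The inverse is unique on \<open>tensor_space\<close> only, hence \<open>SOME\<close> and not \<open>THE\<close>.\<close>

definition tensor_conv_inv ::
  "('k::field \<Rightarrow> 'a::ab_group_add \<Rightarrow> 'a) \<Rightarrow> ('a \<Rightarrow> ('a, 'k) tensor2) \<Rightarrow> ('a \<Rightarrow> 'k) \<Rightarrow>
     (('a, 'k) tensor2 \<Rightarrow> 'k) \<Rightarrow> (('a, 'k) tensor2 \<Rightarrow> 'k)" where
  "tensor_conv_inv s \<Delta> \<epsilon> p = (SOME q. is_tensor_conv_inverse s \<Delta> \<epsilon> p q)"

definition universal_r_form ::
  "('k::field \<Rightarrow> 'a::ring_1 \<Rightarrow> 'a) \<Rightarrow> ('a \<Rightarrow> ('a, 'k) tensor2) \<Rightarrow> ('a \<Rightarrow> 'k) \<Rightarrow>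
     (('a, 'k) tensor2 \<Rightarrow> 'k) \<Rightarrow> bool" where
  "universal_r_form s \<Delta> \<epsilon> r \<longleftrightarrow>
     tensor_functional s r \<and>
     (\<exists>q. is_tensor_conv_inverse s \<Delta> \<epsilon> r q) \<and>
     (\<forall>a b c. r (tensor s c (a * b)) =
        tensor_lift (*) (\<lambda>c1 c2. r (tensor s c1 b) * r (tensor s c2 a)) (\<Delta> c)) \<and>
     (\<forall>a b c. r (tensor s (a * b) c) =
        tensor_lift (*) (\<lambda>c1 c2. r (tensor s a c1) * r (tensor s b c2)) (\<Delta> c)) \<and>
     (\<forall>a b.
        tensor_lift s (\<lambda>a1 a2. tensor_lift s (\<lambda>b1 b2.
          s (r (tensor s a1 b1)) (a2 * b2)) (\<Delta> b)) (\<Delta> a) =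
        tensor_lift s (\<lambda>a1 a2. tensor_lift s (\<lambda>b1 b2.
          s (r (tensor s a2 b2)) (b1 * a1)) (\<Delta> b)) (\<Delta> a))"

locale coquasitriangular_hopf_algebra = hopf_algebra scale \<Delta> \<epsilon> S
  for scale :: "'k::field \<Rightarrow> 'a::ring_1 \<Rightarrow> 'a"
    and \<Delta> :: "'a \<Rightarrow> ('a, 'k) tensor2"
    and \<epsilon> :: "'a \<Rightarrow> 'k"
    and S :: "'a \<Rightarrow> 'a" +
  fixes r :: "('a, 'k) tensor2 \<Rightarrow> 'k"
  assumes r_form: "universal_r_form scale \<Delta> \<epsilon> r"

text \<open>For a universal r-form \<open>r\<close>, \<open>second_r_form\<close> is \<open>(inverse of r)\<^sub>2\<^sub>1\<close>.\<close>

definition second_r_form ::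
  "('k::field \<Rightarrow> 'a::ab_group_add \<Rightarrow> 'a) \<Rightarrow> ('a \<Rightarrow> ('a, 'k) tensor2) \<Rightarrow> ('a \<Rightarrow> 'k) \<Rightarrow>
     (('a, 'k) tensor2 \<Rightarrow> 'k) \<Rightarrow> (('a, 'k) tensor2 \<Rightarrow> 'k)" where
  "second_r_form s \<Delta> \<epsilon> r = (\<lambda>T. tensor_conv_inv s \<Delta> \<epsilon> r (tensor_flip s T))"

definition f_form ::
  "('k::field \<Rightarrow> 'a::ab_group_add \<Rightarrow> 'a) \<Rightarrow> ('a \<Rightarrow> ('a, 'k) tensor2) \<Rightarrow> ('a \<Rightarrow> 'a) \<Rightarrow>
     (('a, 'k) tensor2 \<Rightarrow> 'k) \<Rightarrow> 'a \<Rightarrow> 'k" where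
  "f_form s \<Delta> S t a = tensor_lift (*) (\<lambda>a1 a2. t (tensor s a1 (S a2))) (\<Delta> a)"

definition fbar_form ::
  "('k::field \<Rightarrow> 'a::ab_group_add \<Rightarrow> 'a) \<Rightarrow> ('a \<Rightarrow> ('a, 'k) tensor2) \<Rightarrow> ('a \<Rightarrow> 'k) \<Rightarrow>
     ('a \<Rightarrow> 'a) \<Rightarrow> (('a, 'k) tensor2 \<Rightarrow> 'k) \<Rightarrow> 'a \<Rightarrow> 'k" where
  "fbar_form s \<Delta> \<epsilon> S t a =
     tensor_lift (*) (\<lambda>a1 a2. tensor_conv_inv s \<Delta> \<epsilon> t (tensor s (S a1) a2)) (\<Delta> a)"

end

theory Submission
  imports Defs
begin

text \<open>In the dual algebra \<open>U\<close> of \<open>A\<close>, write the r-form as a formal sum \<open>R = R\<^sub>1 \<otimes> R\<^sub>2\<close> of pairs of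
  functionals, and let \<open>\<Delta>\<close> also denote the coproduct of \<open>U\<close> that is dual to the product of \<open>A\<close>.
  The axioms become \<open>(\<Delta> \<otimes> 1)R = R\<^sub>1\<^sub>3 R\<^sub>2\<^sub>3\<close>, \<open>(1 \<otimes> \<Delta>)R = R\<^sub>1\<^sub>3 R\<^sub>1\<^sub>2\<close> and \<open>R \<Delta>(h) = \<Delta>\<^sup>o\<^sup>p(h) R\<close>,
  and the functional \<open>f\<close> is the Drinfeld-type element \<open>v = R\<^sub>1 S(R\<^sub>2)\<close>.  Two facts about \<open>v\<close> imply
  everything.

  The first is \<open>h v = v S\<^sup>2(h)\<close>.  Multiplying out \<open>R \<Delta>(h) = \<Delta>\<^sup>o\<^sup>p(h) R\<close> with the antipode on the second
  leg yields \<open>h\<^sub>2 v S(h\<^sub>1) = \<epsilon>(h) v\<close> (\<open>f_antipode_absorb\<close>), and the rule follows by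
  multiplying this, for \<open>h\<^sub>2\<close> in place of \<open>h\<close>, by \<open>S\<^sup>2(h\<^sub>1)\<close> from the right, because
  \<open>S(h\<^sub>2) S\<^sup>2(h\<^sub>1) = S(S(h\<^sub>1) h\<^sub>2)\<close> cancels (\<open>f_antipode_square\<close>).  The rule also makes
  \<open>S(R\<^sup>-\<^sup>1\<^sub>1) R\<^sup>-\<^sup>1\<^sub>2\<close> a two-sided inverse of \<open>v\<close>.
  The second is \<open>\<Delta>(v) = (R\<^sub>2\<^sub>1 R)\<^sup>-\<^sup>1 (v \<otimes> v)\<close> (\<open>f_mult\<close>).

  Both facts hold for every r-form, hence for \<open>R\<close> and for \<open>R\<^sub>2\<^sub>1\<^sup>-\<^sup>1\<close>, with elements \<open>v\<close> and \<open>w\<close>.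
  The element \<open>w\<close> is fixed by \<open>S\<^sup>2\<close>, so it commutes with \<open>v\<close>, and then so do the inverses.  Conjugation by
  \<open>v\<close> and by \<open>w\<close> are both \<open>S\<^sup>2\<close>, so \<open>v w\<^sup>-\<^sup>1\<close> is central and conjugation by \<open>v w\<close> is \<open>S\<^sup>4\<close>.  Since
  \<open>\<Delta>(w) = (R\<^sub>2\<^sub>1 R) (w \<otimes> w)\<close>, and \<open>v \<otimes> v\<close> commutes with the \<open>S\<^sup>2\<close>-invariant \<open>R\<^sub>2\<^sub>1 R\<close>, these factors
  cancel in \<open>\<Delta>(v w) = v w \<otimes> v w\<close>, which says that \<open>v w\<close> is a character of \<open>A\<close>.

  All computations are carried out with scalar-valued Sweedler sums of multilinear forms.  An identity
  in \<open>A\<close> is tested against an arbitrary functional \<open>h\<close>; functionals separate the points of a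
  vector space.  In the comments, \<open>a\<^sub>1, a\<^sub>2, \<dots>\<close> are the Sweedler components of \<open>a\<close>.\<close>

section \<open>Functionals on the free space and on the tensor square\<close>

lemma lookup_free_scale: "Poly_Mapping.lookup (free_scale c u) x = c * Poly_Mapping.lookup u x"
  by (simp add: free_scale_def Poly_Mapping.map.rep_eq when_def)

lemma vector_space_free_scale: "vector_space (free_scale :: 'k::field \<Rightarrow> ('x \<Rightarrow>\<^sub>0 'k) \<Rightarrow> _)"
  by unfold_locales
     (auto intro!: poly_mapping_eqI simp: lookup_free_scale lookup_add algebra_simps)

lemma free_lift_superset:
  fixes \<phi> :: "'x \<Rightarrow> 'k::field"
  assumes "finite K" "Poly_Mapping.keys u \<subseteq> K"
  shows "free_lift (*) \<phi> u = (\<Sum>x\<in>K. Poly_Mapping.lookup u x * \<phi> x)"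
  unfolding free_lift_def using assms by (intro sum.mono_neutral_left) (auto simp: in_keys_iff)

lemma free_lift_add:
  fixes \<phi> :: "'x \<Rightarrow> 'k::field"
  shows "free_lift (*) \<phi> (u + v) = free_lift (*) \<phi> u + free_lift (*) \<phi> v"
  unfolding free_lift_def by (rule setsum_keys_plus_distrib) (auto simp: algebra_simps)

lemma free_lift_free_scale:
  fixes \<phi> :: "'x \<Rightarrow> 'k::field"
  shows "free_lift (*) \<phi> (free_scale c u) = c * free_lift (*) \<phi> u"
proof -
  have "Poly_Mapping.keys (free_scale c u) \<subseteq> Poly_Mapping.keys u"
    by (auto simp: in_keys_iff lookup_free_scale)
  then have "free_lift (*) \<phi> (free_scale c u) =
      (\<Sum>x\<in>Poly_Mapping.keys u. Poly_Mapping.lookup (free_scale c u) x * \<phi> x)"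
    by (intro free_lift_superset) auto
  then show ?thesis
    by (simp add: free_lift_def lookup_free_scale sum_distrib_left mult.assoc)
qed

lemma free_lift_zero: "free_lift (*) (\<phi> :: 'x \<Rightarrow> 'k::field) 0 = 0"
  by (simp add: free_lift_def)

lemma free_lift_diff:
  fixes \<phi> :: "'x \<Rightarrow> 'k::field"
  shows "free_lift (*) \<phi> (u - v) = free_lift (*) \<phi> u - free_lift (*) \<phi> v"
  using free_lift_add[of \<phi> "u - v" v] by simp

lemma free_lift_single: "free_lift (*) \<phi> (Poly_Mapping.single x c) = c * (\<phi> x :: 'k::field)"
  by (subst free_lift_superset[of "{x}"]) auto

lemma free_lift_sum:
  "free_lift (*) (\<phi> :: 'x \<Rightarrow> 'k::field) (\<Sum>i\<in>I. u i) = (\<Sum>i\<in>I. free_lift (*) \<phi> (u i))"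
  by (induction I rule: infinite_finite_induct) (auto simp: free_lift_zero free_lift_add)

text \<open>Both sides refer to the same representative of the tensor, so this is only the linearity of
  \<open>free_lift\<close>, whatever \<open>\<Phi>\<close> is.  It reduces iterated tensor-valued sums to scalar ones.\<close>

lemma free_lift_tensor_lift:
  "free_lift (*) (\<psi> :: 'x \<Rightarrow> 'k::field) (tensor_lift free_scale \<Phi> T) =
   tensor_lift (*) (\<lambda>x y. free_lift (*) \<psi> (\<Phi> x y)) T"
  unfolding tensor_lift_def free_lift_def[of free_scale]
  unfolding free_lift_sum free_lift_free_scale
  by (simp add: free_lift_def case_prod_unfold)

lemma free_lift_vanishes_on_span:
  fixes \<phi> :: "'x \<Rightarrow> 'k::field"
  assumes "u \<in> module.span free_scale R" and "\<And>v. v \<in> R \<Longrightarrow> free_lift (*) \<phi> v = 0"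
  shows "free_lift (*) \<phi> u = 0"
proof -
  interpret V: vector_space "free_scale :: 'k \<Rightarrow> ('x \<Rightarrow>\<^sub>0 'k) \<Rightarrow> _"
    by (rule vector_space_free_scale)
  show ?thesis using assms(1)
    by (induction rule: V.span_induct_alt)
       (auto simp: free_lift_zero free_lift_add free_lift_free_scale assms(2))
qed

lemma free_functional_eq_free_lift:
  fixes F :: "('x \<Rightarrow>\<^sub>0 'k::field) \<Rightarrow> 'k"
  assumes add: "\<And>u v. F (u + v) = F u + F v" and scale: "\<And>c u. F (free_scale c u) = c * F u"
  shows "F u = free_lift (*) (\<lambda>x. F (Poly_Mapping.single x 1)) u"
proof (induction u rule: update_induct)
  case const
  have "F 0 = 0" using add[of 0 0] by (metis add.right_neutral add_cancel_left_left)
  then show ?case by (simp add: free_lift_zero)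
next
  case (update u x c)
  have "free_scale c (Poly_Mapping.single x 1) = Poly_Mapping.single x c"
    by (rule poly_mapping_eqI) (simp add: lookup_free_scale lookup_single when_def)
  moreover have "Poly_Mapping.update x c u = u + Poly_Mapping.single x c"
    using update(1)
    by (intro poly_mapping_eqI)
       (auto simp: lookup_update lookup_add lookup_single when_def in_keys_iff)
  ultimately show ?case
    using scale[of c "Poly_Mapping.single x 1"]
    by (simp add: add update.IH free_lift_add free_lift_single)
qed

context algebra_over_field begin

definition lin :: "('a \<Rightarrow> 'k) \<Rightarrow> bool" where
  "lin f \<longleftrightarrow> (\<forall>x y. f (x + y) = f x + f y) \<and> (\<forall>c x. f (scale c x) = c * f x)"

definition endo :: "('a \<Rightarrow> 'a) \<Rightarrow> bool" where
  "endo F \<longleftrightarrow> (\<forall>x y. F (x + y) = F x + F y) \<and> (\<forall>c x. F (scale c x) = scale c (F x))"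

definition bilin :: "('a \<Rightarrow> 'a \<Rightarrow> 'k) \<Rightarrow> bool" where
  "bilin \<phi> \<longleftrightarrow> (\<forall>y. lin (\<lambda>x. \<phi> x y)) \<and> (\<forall>x. lin (\<lambda>y. \<phi> x y))"

lemma lin_iff_linear: "lin f \<longleftrightarrow> Vector_Spaces.linear scale (*) f"
  unfolding lin_def Vector_Spaces.linear_iff
  by (auto intro: vector_space_axioms simp: vector_space_def algebra_simps)

lemma lin_iff_dual_space: "lin f \<longleftrightarrow> f \<in> dual_space scale"
  by (simp add: lin_iff_linear dual_space_def)

text \<open>Extend \<open>x - y\<close> to a basis.  This is what allows identities between elements of the algebra
  to be proved by scalar computations.\<close>

lemma functional_separates:
  assumes "\<And>h. lin h \<Longrightarrow> h x = h y"
  shows "x = y"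
proof (rule ccontr)
  assume "x \<noteq> y"
  interpret P: vector_space_pair scale "(*) :: 'k \<Rightarrow> 'k \<Rightarrow> 'k"
    by unfold_locales (auto simp: algebra_simps)
  have ind: "independent {x - y}"
    using \<open>x \<noteq> y\<close> by simp
  define h where "h = P.construct {x - y} (\<lambda>_. 1)"
  have "lin h"
    unfolding h_def lin_iff_linear by (rule P.linear_construct[OF ind])
  moreover have "h (x - y) = 1"
    unfolding h_def by (rule P.construct_basis[OF ind]) simp
  ultimately show False
    using assms[of h] by (metis lin_def add.right_neutral add_diff_cancel_left' diff_add_cancel one_neq_zero)
qed

subsection \<open>Classes in the tensor square\<close>

lemma tensor_class_eq_iff:
  "tensor_class scale u = tensor_class scale v \<longleftrightarrow>
     u - v \<in> module.span free_scale (tensor_relators scale)"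
proof -
  interpret V: vector_space "free_scale :: 'k \<Rightarrow> (('a \<times> 'a) \<Rightarrow>\<^sub>0 'k) \<Rightarrow> _"
    by (rule vector_space_free_scale)
  show ?thesis
  proof
    assume "tensor_class scale u = tensor_class scale v"
    moreover have "v \<in> tensor_class scale v"
      by (simp add: tensor_class_def tensor_rel_def V.span_zero)
    ultimately show "u - v \<in> V.span (tensor_relators scale)"
      by (auto simp: tensor_class_def tensor_rel_def)
  next
    assume uv: "u - v \<in> V.span (tensor_relators scale)"
    have "u - w \<in> V.span (tensor_relators scale) \<longleftrightarrow> v - w \<in> V.span (tensor_relators scale)" for w
    proof -
      have "u - w = (u - v) + (v - w)" "v - w = (u - w) - (u - v)"
        by simp_all
      then show ?thesis
        by (metis V.span_add V.span_diff uv)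
    qed
    then show "tensor_class scale u = tensor_class scale v"
      by (auto simp: tensor_class_def tensor_rel_def)
  qed
qed

lemma tensor_class_in_space: "tensor_class scale u \<in> tensor_space scale"
  by (simp add: tensor_class_def tensor_space_def quotientI)

lemma tensor_rep_class:
  "tensor_rep (tensor_class scale u) - u \<in> module.span free_scale (tensor_relators scale)"
proof -
  interpret V: vector_space "free_scale :: 'k \<Rightarrow> (('a \<times> 'a) \<Rightarrow>\<^sub>0 'k) \<Rightarrow> _"
    by (rule vector_space_free_scale)
  have "u \<in> tensor_class scale u"
    by (simp add: tensor_class_def tensor_rel_def V.span_zero)
  then have "tensor_rep (tensor_class scale u) \<in> tensor_class scale u"
    unfolding tensor_rep_def by (rule someI)
  then show ?thesis
    using V.span_neg by (fastforce simp: tensor_class_def tensor_rel_def)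
qed

lemma tensor_class_rep:
  assumes "T \<in> tensor_space scale"
  shows "tensor_class scale (tensor_rep T) = T"
proof -
  obtain u where "T = tensor_class scale u"
    using assms by (auto simp: tensor_space_def tensor_class_def quotient_def)
  then show ?thesis using tensor_rep_class tensor_class_eq_iff by blast
qed

text \<open>This is where the quotient does its work: a bilinear form takes the same value on every
  representative of a tensor.\<close>

lemma tensor_lift_class:
  assumes "bilin \<phi>"
  shows "tensor_lift (*) \<phi> (tensor_class scale u) = free_lift (*) (\<lambda>(x, y). \<phi> x y) u"
proof -
  have "free_lift (*) (\<lambda>(x, y). \<phi> x y) (tensor_rep (tensor_class scale u) - u) = 0"
    using tensor_rep_class
  proof (rule free_lift_vanishes_on_span)
    show "free_lift (*) (\<lambda>(x, y). \<phi> x y) v = 0" if "v \<in> tensor_relators scale" for v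
      using that assms
      by (auto simp: tensor_relators_def free_lift_diff free_lift_single bilin_def lin_def)
  qed
  then show ?thesis
    by (simp add: tensor_lift_def free_lift_diff)
qed

lemma tensor_lift_tensor: "bilin \<phi> \<Longrightarrow> tensor_lift (*) \<phi> (tensor scale x y) = \<phi> x y"
  by (simp add: tensor_def tensor_lift_class free_lift_single)

lemma tensor_lift_add:
  "bilin \<phi> \<Longrightarrow> tensor_lift (*) \<phi> (tensor_add scale T U) = tensor_lift (*) \<phi> T + tensor_lift (*) \<phi> U"
  by (simp add: tensor_add_def tensor_lift_class free_lift_add) (simp add: tensor_lift_def)

lemma tensor_lift_scale:
  "bilin \<phi> \<Longrightarrow> tensor_lift (*) \<phi> (tensor_scale scale c T) = c * tensor_lift (*) \<phi> T"
  by (simp add: tensor_scale_def tensor_lift_class free_lift_free_scale) (simp add: tensor_lift_def)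

lemma lin_tensor_lift:
  fixes \<phi> :: "'a \<Rightarrow> 'a \<Rightarrow> 'a"
  assumes "lin h"
  shows "h (tensor_lift scale \<phi> T) = tensor_lift (*) (\<lambda>x y. h (\<phi> x y)) T"
proof -
  have 0: "h 0 = 0" using assms by (metis lin_def add_cancel_right_right)
  have sum: "h (\<Sum>i\<in>I. g i) = (\<Sum>i\<in>I. h (g i))" for I and g :: "'a \<times> 'a \<Rightarrow> 'a"
    using assms by (induction I rule: infinite_finite_induct) (auto simp: lin_def 0)
  show ?thesis
    using assms by (simp add: tensor_lift_def free_lift_def case_prod_unfold lin_def sum)
qed

lemma tensor_add_class:
  "tensor_add scale (tensor_class scale u) (tensor_class scale v) = tensor_class scale (u + v)"
proof -
  interpret V: vector_space "free_scale :: 'k \<Rightarrow> (('a \<times> 'a) \<Rightarrow>\<^sub>0 'k) \<Rightarrow> _"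
    by (rule vector_space_free_scale)
  show ?thesis
    unfolding tensor_add_def tensor_class_eq_iff
    using V.span_add[OF tensor_rep_class[of u] tensor_rep_class[of v]] by (simp add: algebra_simps)
qed

lemma tensor_scale_class:
  "tensor_scale scale c (tensor_class scale u) = tensor_class scale (free_scale c u)"
proof -
  interpret V: vector_space "free_scale :: 'k \<Rightarrow> (('a \<times> 'a) \<Rightarrow>\<^sub>0 'k) \<Rightarrow> _"
    by (rule vector_space_free_scale)
  show ?thesis
    unfolding tensor_scale_def tensor_class_eq_iff
    using V.span_scale[OF tensor_rep_class[of u], of c] by (simp add: V.scale_right_diff_distrib)
qed

subsection \<open>Linear functionals on the tensor square are bilinear forms\<close>

lemma tensor_functional_lift: "bilin \<phi> \<Longrightarrow> tensor_functional scale (tensor_lift (*) \<phi>)"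
  by (simp add: tensor_functional_def tensor_lift_add tensor_lift_scale)

lemma bilin_tensor_functional:
  assumes "tensor_functional scale p"
  shows "bilin (\<lambda>x y. p (tensor scale x y))"
proof -
  interpret V: vector_space "free_scale :: 'k \<Rightarrow> (('a \<times> 'a) \<Rightarrow>\<^sub>0 'k) \<Rightarrow> _"
    by (rule vector_space_free_scale)
  have single: "free_scale c (Poly_Mapping.single z 1) = Poly_Mapping.single z c" for c z
    by (rule poly_mapping_eqI) (simp add: lookup_free_scale lookup_single when_def)
  have "tensor scale (x + x') y = tensor_add scale (tensor scale x y) (tensor scale x' y)"
    and "tensor scale x (y + y') = tensor_add scale (tensor scale x y) (tensor scale x y')"
    and "tensor scale (scale c x) y = tensor_scale scale c (tensor scale x y)"
    and "tensor scale x (scale c y) = tensor_scale scale c (tensor scale x y)" for x x' y y' c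
    unfolding tensor_def tensor_add_class tensor_scale_class tensor_class_eq_iff single
    by (rule V.span_base; fastforce simp: tensor_relators_def diff_diff_eq)+
  then show ?thesis
    using assms unfolding bilin_def lin_def tensor_functional_def
    by (simp add: tensor_def tensor_class_in_space)
qed

text \<open>Hence nothing is lost by working with the bilinear form \<open>\<lambda>x y. p (x \<otimes> y)\<close> instead of \<open>p\<close>.\<close>

lemma tensor_functional_eq_lift:
  assumes "tensor_functional scale p" and "T \<in> tensor_space scale"
  shows "p T = tensor_lift (*) (\<lambda>x y. p (tensor scale x y)) T"
proof -
  have "p (tensor_class scale u) = free_lift (*) (\<lambda>z. p (tensor_class scale (Poly_Mapping.single z 1))) u" for u
    using assms(1)
    by (intro free_functional_eq_free_lift)
       (simp_all add: tensor_functional_def tensor_class_in_space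
          flip: tensor_add_class tensor_scale_class)
  from this[of "tensor_rep T"] show ?thesis
    by (simp add: tensor_class_rep[OF assms(2)] tensor_lift_def tensor_def case_prod_unfold)
qed

lemma tensor_flip_in_space: "tensor_flip scale T \<in> tensor_space scale"
  by (simp add: tensor_flip_def tensor_class_in_space)

lemma tensor_lift_flip:
  assumes "bilin \<phi>"
  shows "tensor_lift (*) \<phi> (tensor_flip scale T) = tensor_lift (*) (\<lambda>x y. \<phi> y x) T"
  using assms by (simp add: tensor_flip_def tensor_lift_class free_lift_tensor_lift free_lift_single)

subsection \<open>Rules for multilinearity\<close>

text \<open>Multilinearity of an explicit Sweedler expression is decided by its syntax: each variable
  occurs in exactly one factor, so that at every step exactly one of these introduction rules
  applies.\<close>

lemma lin_mult_right: "lin f \<Longrightarrow> lin (\<lambda>x. f x * c)"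
  and lin_mult_left: "lin f \<Longrightarrow> lin (\<lambda>x. c * f x)"
  by (auto simp: lin_def algebra_simps)

lemma lin_compose: "lin h \<Longrightarrow> endo F \<Longrightarrow> lin (\<lambda>x. h (F x))"
  by (auto simp: lin_def endo_def)

lemma endo_id: "endo (\<lambda>x. x)"
  by (simp add: endo_def)

lemma endo_mult_right: "endo F \<Longrightarrow> endo (\<lambda>x. F x * c)"
  and endo_mult_left: "endo F \<Longrightarrow> endo (\<lambda>x. c * F x)"
  by (auto simp: endo_def algebra_simps scale_mult_left scale_mult_right)

lemma bilinI: "(\<And>y. lin (\<lambda>x. \<phi> x y)) \<Longrightarrow> (\<And>x. lin (\<lambda>y. \<phi> x y)) \<Longrightarrow> bilin \<phi>"
  by (simp add: bilin_def)

lemma lin_bilin_left: "bilin \<phi> \<Longrightarrow> endo F \<Longrightarrow> lin (\<lambda>x. \<phi> (F x) y)"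
  and lin_bilin_right: "bilin \<phi> \<Longrightarrow> endo F \<Longrightarrow> lin (\<lambda>x. \<phi> y (F x))"
  by (auto simp: bilin_def lin_def endo_def)

lemma lin_tensor_lift_param:
  "(\<And>x y. lin (\<lambda>z. \<phi> z x y)) \<Longrightarrow> lin (\<lambda>z. tensor_lift (*) (\<lambda>x y. \<phi> z x y) T)"
  by (simp add: lin_def tensor_lift_def free_lift_def case_prod_unfold sum.distrib
      sum_distrib_left algebra_simps)

lemmas lin_intros = bilinI lin_mult_right lin_mult_left endo_id endo_mult_right endo_mult_left

end

section \<open>Sweedler sums\<close>

context bialgebra begin

definition sw :: "'a \<Rightarrow> ('a \<Rightarrow> 'a \<Rightarrow> 'k) \<Rightarrow> 'k" where
  "sw a \<phi> = tensor_lift (*) \<phi> (\<Delta> a)"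

lemma sw_cong: "(\<And>x y. \<phi> x y = \<psi> x y) \<Longrightarrow> sw a \<phi> = sw a \<psi>"
  by presburger

lemma sw_as_sum:
  "sw a \<phi> = (\<Sum>(x, y)\<in>Poly_Mapping.keys (tensor_rep (\<Delta> a)).
     Poly_Mapping.lookup (tensor_rep (\<Delta> a)) (x, y) * \<phi> x y)"
  by (simp add: sw_def tensor_lift_def free_lift_def case_prod_unfold)

lemma sw_swap: "sw a (\<lambda>x y. sw b (\<lambda>u v. \<phi> x y u v)) = sw b (\<lambda>u v. sw a (\<lambda>x y. \<phi> x y u v))"
  unfolding sw_as_sum case_prod_unfold sum_distrib_left by (subst sum.swap) (simp add: mult.left_commute)

lemma sw_mult_left: "sw a (\<lambda>x y. c * \<phi> x y) = c * sw a \<phi>"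
  by (simp add: sw_as_sum case_prod_unfold sum_distrib_left mult.left_commute)

lemma sw_mult_right: "sw a (\<lambda>x y. \<phi> x y * c) = sw a \<phi> * c"
  by (simp add: sw_as_sum case_prod_unfold sum_distrib_right mult.assoc)

lemma lin_sw: "bilin \<phi> \<Longrightarrow> lin (\<lambda>a. sw a \<phi>)"
  by (simp add: lin_def sw_def comult_add comult_scale tensor_lift_add tensor_lift_scale)

lemma lin_sw_argument: "endo F \<Longrightarrow> bilin \<phi> \<Longrightarrow> lin (\<lambda>a. sw (F a) \<phi>)"
  using lin_compose[OF lin_sw] by blast

lemma lin_sw_param: "(\<And>x y. lin (\<lambda>z. \<phi> z x y)) \<Longrightarrow> lin (\<lambda>z. sw a (\<lambda>x y. \<phi> z x y))"
  unfolding sw_def by (rule lin_tensor_lift_param)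

lemma lin_counit: "lin \<epsilon>"
  using counit_linear by (simp add: lin_iff_linear)

lemmas lins = lin_intros lin_sw_argument lin_sw_param lin_compose[OF lin_counit]

text \<open>The trilinear form \<open>\<phi>\<close> extends to the free space on triples and vanishes there on the relators
  of the tensor cube.\<close>

lemma coassoc_sw:
  assumes "\<And>v y. lin (\<lambda>u. \<phi> u v y)" "\<And>u y. lin (\<lambda>v. \<phi> u v y)" "\<And>u v. lin (\<lambda>y. \<phi> u v y)"
  shows "sw a (\<lambda>x y. sw x (\<lambda>u v. \<phi> u v y)) = sw a (\<lambda>x y. sw y (\<lambda>u v. \<phi> x u v))"
proof -
  interpret V: vector_space "free_scale :: 'k \<Rightarrow> (('a \<times> 'a \<times> 'a) \<Rightarrow>\<^sub>0 'k) \<Rightarrow> _"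
    by (rule vector_space_free_scale)
  define L where "L = tensor_lift free_scale (\<lambda>x y. tensor_lift free_scale
         (\<lambda>x1 x2. Poly_Mapping.single (x1, x2, y) (1::'k)) (\<Delta> x)) (\<Delta> a)"
  define R where "R = tensor_lift free_scale (\<lambda>x y. tensor_lift free_scale
         (\<lambda>y1 y2. Poly_Mapping.single (x, y1, y2) (1::'k)) (\<Delta> y)) (\<Delta> a)"
  let ?\<psi> = "\<lambda>(u, v, w). \<phi> u v w"
  have "R \<in> tensor3_class scale L"
    unfolding coassoc[of a, folded L_def R_def] by (simp add: tensor3_class_def tensor3_rel_def V.span_zero)
  then have "L - R \<in> V.span (tensor3_relators scale)"
    by (simp add: tensor3_class_def tensor3_rel_def)
  then have "free_lift (*) ?\<psi> (L - R) = 0"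
  proof (rule free_lift_vanishes_on_span)
    show "free_lift (*) ?\<psi> v = 0" if "v \<in> tensor3_relators scale" for v
      using that assms
      by (auto simp: tensor3_relators_def free_lift_diff free_lift_single lin_def)
  qed
  then show ?thesis
    by (simp add: free_lift_diff L_def R_def free_lift_tensor_lift free_lift_single sw_def)
qed

lemma counit_left_sw:
  assumes "lin h"
  shows "sw a (\<lambda>x y. \<epsilon> x * h y) = h a"
proof -
  have "h a = sw a (\<lambda>x y. h (scale (\<epsilon> x) y))"
    unfolding sw_def lin_tensor_lift[OF assms, symmetric] counit_left ..
  then show ?thesis using assms by (simp add: lin_def)
qed

lemma counit_right_sw:
  assumes "lin h"
  shows "sw a (\<lambda>x y. \<epsilon> y * h x) = h a"
proof -
  have "h a = sw a (\<lambda>x y. h (scale (\<epsilon> y) x))"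
    unfolding sw_def lin_tensor_lift[OF assms, symmetric] counit_right ..
  then show ?thesis using assms by (simp add: lin_def)
qed

lemma sw_mult:
  assumes "bilin \<phi>"
  shows "sw (a * b) \<phi> = sw a (\<lambda>x y. sw b (\<lambda>u v. \<phi> (x * u) (y * v)))"
  using assms
  by (simp add: sw_def comult_mult tensor_mult_def tensor_lift_class free_lift_tensor_lift free_lift_single)

lemma sw_one: "bilin \<phi> \<Longrightarrow> sw 1 \<phi> = \<phi> 1 1"
  by (simp add: sw_def comult_one tensor_lift_tensor)

text \<open>The components \<open>a\<^sub>1, \<dots>, a\<^sub>4\<close> arise by splitting both halves of \<open>\<Delta>(a)\<close>, or by splitting off
  \<open>a\<^sub>1\<close>, then \<open>a\<^sub>4\<close>, and splitting what remains.  The second form exposes the adjacent pair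
  \<open>a\<^sub>2, a\<^sub>3\<close> to an antipode or an r-form.\<close>

lemma coassoc4_sw:
  assumes "\<And>u v y. lin (\<lambda>x. \<phi> x u v y)" "\<And>x v y. lin (\<lambda>u. \<phi> x u v y)"
    "\<And>x u y. lin (\<lambda>v. \<phi> x u v y)" "\<And>x u v. lin (\<lambda>y. \<phi> x u v y)"
  shows "sw a (\<lambda>x y. sw x (\<lambda>x1 x2. sw y (\<lambda>y1 y2. \<phi> x1 x2 y1 y2))) =
    sw a (\<lambda>x y. sw y (\<lambda>u v. sw u (\<lambda>u1 u2. \<phi> x u1 u2 v)))"
proof -
  have "sw a (\<lambda>x y. sw x (\<lambda>x1 x2. sw y (\<lambda>y1 y2. \<phi> x1 x2 y1 y2))) =
     sw a (\<lambda>x y. sw y (\<lambda>u v. sw v (\<lambda>y1 y2. \<phi> x u y1 y2)))"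
    by (rule coassoc_sw; intro lins assms)
  also have "\<dots> = sw a (\<lambda>x y. sw y (\<lambda>u v. sw u (\<lambda>u1 u2. \<phi> x u1 u2 v)))"
    by (rule sw_cong, rule coassoc_sw[symmetric]; intro lins assms)
  finally show ?thesis .
qed

end

section \<open>The antipode\<close>

context hopf_algebra begin

lemma endo_antipode: "endo S"
  using antipode_linear by (simp add: endo_def Vector_Spaces.linear_iff)

lemma endo_S: "endo F \<Longrightarrow> endo (\<lambda>x. S (F x))"
  using endo_antipode by (simp add: endo_def)

lemmas S_lins = lins endo_S

lemma antipode_left_sw:
  assumes "lin h"
  shows "sw a (\<lambda>x y. h (S x * y)) = \<epsilon> a * h 1"
  using lin_tensor_lift[OF assms, of "\<lambda>x y. S x * y" "\<Delta> a"] assms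
  by (simp add: antipode_left sw_def lin_def)

lemma antipode_right_sw:
  assumes "lin h"
  shows "sw a (\<lambda>x y. h (x * S y)) = \<epsilon> a * h 1"
  using lin_tensor_lift[OF assms, of "\<lambda>x y. x * S y" "\<Delta> a"] assms
  by (simp add: antipode_right sw_def lin_def)

lemma antipode_one: "S 1 = 1"
proof (rule functional_separates)
  fix h assume h: "lin h"
  note hl = lin_compose[OF h] S_lins
  show "h (S 1) = h 1"
    using antipode_left_sw[OF h, of 1] by (subst (asm) sw_one) (intro hl | simp add: counit_one)+
qed

lemma counit_antipode: "\<epsilon> (S a) = \<epsilon> a"
proof -
  have "\<epsilon> (S a) = sw a (\<lambda>x y. \<epsilon> y * \<epsilon> (S x))"
    by (rule counit_right_sw[symmetric]; intro S_lins)
  also have "\<dots> = \<epsilon> a * \<epsilon> 1"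
    by (subst antipode_left_sw[OF lin_counit, symmetric]) (simp add: counit_mult mult.commute)
  finally show ?thesis by (simp add: counit_one)
qed

text \<open>Both sides are convolution inverses of the multiplication map on \<open>A \<otimes> A\<close>.  Concretely,
  \<open>S(a\<^sub>1 b\<^sub>1) a\<^sub>2 b\<^sub>2 S(b\<^sub>3) S(a\<^sub>3)\<close> collapses to one side when it is contracted from the right, and
  to the other side when it is contracted from the left.\<close>

lemma antipode_mult: "S (a * b) = S b * S a"
proof (rule functional_separates)
  fix h assume h: "lin h"
  note hl = lin_compose[OF h] S_lins
  have "h (S (a * b)) = sw a (\<lambda>x y. sw b (\<lambda>u v. \<epsilon> y * (\<epsilon> v * h (S (x * u)))))"
    unfolding sw_mult_left
    by (subst (2) counit_right_sw, intro hl, subst counit_right_sw, intro hl, rule refl)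
  also have "\<dots> = sw a (\<lambda>x y. sw b (\<lambda>u v.
      sw y (\<lambda>y1 y2. sw v (\<lambda>v1 v2. h (S (x * u) * (y1 * (v1 * S v2) * S y2))))))"
  proof (rule sw_cong, rule sw_cong)
    fix x y u v
    have "sw v (\<lambda>v1 v2. h (S (x * u) * (y1 * (v1 * S v2) * S y2))) =
        \<epsilon> v * h (S (x * u) * (y1 * S y2))" for y1 y2
      by (subst antipode_right_sw[where h = "\<lambda>z. h (S (x * u) * (y1 * z * S y2))"]) (intro hl, simp)
    moreover have "sw y (\<lambda>y1 y2. h (S (x * u) * (y1 * S y2))) = \<epsilon> y * h (S (x * u))"
      by (subst antipode_right_sw[where h = "\<lambda>z. h (S (x * u) * z)"]) (intro hl, simp)
    ultimately show "\<epsilon> y * (\<epsilon> v * h (S (x * u))) =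
        sw y (\<lambda>y1 y2. sw v (\<lambda>v1 v2. h (S (x * u) * (y1 * (v1 * S v2) * S y2))))"
      by (simp add: sw_mult_left)
  qed
  also have "\<dots> = sw a (\<lambda>x y. sw y (\<lambda>y1 y2. sw b (\<lambda>u v. sw v (\<lambda>v1 v2.
      h (S (x * u) * (y1 * (v1 * S v2) * S y2))))))"
    by (rule sw_cong, rule sw_swap)
  also have "\<dots> = sw a (\<lambda>x y. sw x (\<lambda>x1 x2. sw b (\<lambda>u v. sw v (\<lambda>v1 v2.
      h (S (x1 * u) * (x2 * (v1 * S v2) * S y))))))"
    by (rule coassoc_sw[symmetric]; intro hl)
  also have "\<dots> = sw a (\<lambda>x y. sw x (\<lambda>x1 x2. sw b (\<lambda>u v. sw u (\<lambda>u1 u2.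
      h (S (x1 * u1) * (x2 * (u2 * S v) * S y))))))"
    by (rule sw_cong, rule sw_cong, rule coassoc_sw[symmetric]; intro hl)
  also have "\<dots> = sw a (\<lambda>x y. sw b (\<lambda>u v. sw x (\<lambda>x1 x2. sw u (\<lambda>u1 u2.
      h (S (x1 * u1) * (x2 * u2) * (S v * S y))))))"
    unfolding mult.assoc by (rule sw_cong, rule sw_swap)
  also have "\<dots> = sw a (\<lambda>x y. sw b (\<lambda>u v. \<epsilon> x * (\<epsilon> u * h (S v * S y))))"
  proof (rule sw_cong, rule sw_cong)
    fix x y u v
    have "sw x (\<lambda>x1 x2. sw u (\<lambda>u1 u2. h (S (x1 * u1) * (x2 * u2) * (S v * S y)))) =
        sw (x * u) (\<lambda>p q. h (S p * q * (S v * S y)))"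
      by (rule sw_mult[symmetric]) (intro hl)
    also have "\<dots> = \<epsilon> (x * u) * h (S v * S y)"
      by (subst antipode_left_sw[where h = "\<lambda>z. h (z * (S v * S y))"]) (intro hl, simp)
    finally show "sw x (\<lambda>x1 x2. sw u (\<lambda>u1 u2. h (S (x1 * u1) * (x2 * u2) * (S v * S y)))) =
        \<epsilon> x * (\<epsilon> u * h (S v * S y))"
      by (simp add: counit_mult)
  qed
  also have "\<dots> = h (S b * S a)"
    unfolding sw_mult_left
    by (subst (2) counit_left_sw, intro hl, subst counit_left_sw, intro hl, rule refl)
  finally show "h (S (a * b)) = h (S b * S a)" .
qed

text \<open>The contraction of \<open>\<Delta>(a\<^sub>1) (S(a\<^sub>3) \<otimes> S(a\<^sub>2))\<close> to \<open>\<epsilon>(a) 1 \<otimes> 1\<close>, with \<open>p \<otimes> q\<close> in front of it: the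
  inner pair \<open>a\<^sub>2 S(a\<^sub>3)\<close> disappears first, then \<open>a\<^sub>1 S(a\<^sub>4)\<close>.\<close>

lemma antipode_comult_aux:
  assumes \<phi>: "bilin \<phi>"
  shows "sw a (\<lambda>x y. sw x (\<lambda>s t. sw y (\<lambda>m n. \<phi> (p * (s * S n)) (q * (t * S m))))) = \<epsilon> a * \<phi> p q"
proof -
  note \<phi>l = lin_bilin_left[OF \<phi>] lin_bilin_right[OF \<phi>] S_lins
  have "sw a (\<lambda>x y. sw x (\<lambda>s t. sw y (\<lambda>m n. \<phi> (p * (s * S n)) (q * (t * S m))))) =
    sw a (\<lambda>x y. sw y (\<lambda>u n. sw u (\<lambda>t m. \<phi> (p * (x * S n)) (q * (t * S m)))))"
    by (rule coassoc4_sw; intro \<phi>l)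
  also have "\<dots> = sw a (\<lambda>x y. sw y (\<lambda>u n. \<epsilon> u * \<phi> (p * (x * S n)) (q * 1)))"
    by (rule sw_cong, rule sw_cong, rule antipode_right_sw; intro \<phi>l)
  also have "\<dots> = sw a (\<lambda>x y. \<phi> (p * (x * S y)) (q * 1))"
    by (rule sw_cong, rule counit_left_sw; intro \<phi>l)
  also have "\<dots> = \<epsilon> a * \<phi> (p * 1) (q * 1)"
    by (rule antipode_right_sw; intro \<phi>l)
  finally show ?thesis by simp
qed

text \<open>Dually, \<open>\<Delta>(S(a)) = S(a\<^sub>2) \<otimes> S(a\<^sub>1)\<close>, because both sides are convolution inverses of \<open>\<Delta>\<close>: the
  product \<open>\<Delta>(S(a\<^sub>1)) \<Delta>(a\<^sub>2) (S(a\<^sub>4) \<otimes> S(a\<^sub>3))\<close> can be contracted from either end.\<close>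

lemma sw_antipode:
  assumes \<phi>: "bilin \<phi>"
  shows "sw (S a) \<phi> = sw a (\<lambda>x y. \<phi> (S y) (S x))"
proof -
  note \<phi>l = lin_bilin_left[OF \<phi>] lin_bilin_right[OF \<phi>] S_lins
  define \<Psi> where "\<Psi> y P Q = sw y (\<lambda>m n. \<phi> (P * S n) (Q * S m))" for y P Q
  have "sw (S a) \<phi> = sw a (\<lambda>x y. \<epsilon> y * sw (S x) \<phi>)"
    by (rule counit_right_sw[symmetric]; intro \<phi>l)
  also have "\<dots> = sw a (\<lambda>x y. sw (S x) (\<lambda>p q. sw y (\<lambda>y1 y2. sw y1 (\<lambda>s t. \<Psi> y2 (p * s) (q * t)))))"
    by (simp add: \<Psi>_def mult.assoc antipode_comult_aux[OF \<phi>] sw_mult_left)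
  also have "\<dots> = sw a (\<lambda>x y. sw y (\<lambda>y1 y2. sw (S x) (\<lambda>p q. sw y1 (\<lambda>s t. \<Psi> y2 (p * s) (q * t)))))"
    by (rule sw_cong, rule sw_swap)
  also have "\<dots> = sw a (\<lambda>x y. sw y (\<lambda>y1 y2. sw (S x * y1) (\<Psi> y2)))"
    by (intro sw_cong, rule sw_mult[symmetric]) (unfold \<Psi>_def, intro \<phi>l)
  also have "\<dots> = sw a (\<lambda>x y. sw x (\<lambda>x1 x2. sw (S x1 * x2) (\<Psi> y)))"
    by (rule coassoc_sw[symmetric]; unfold \<Psi>_def; intro \<phi>l)
  also have "\<dots> = sw a (\<lambda>x y. \<epsilon> x * sw 1 (\<Psi> y))"
    by (rule sw_cong, rule antipode_left_sw; unfold \<Psi>_def; intro \<phi>l)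
  also have "\<dots> = sw 1 (\<Psi> a)"
    by (rule counit_left_sw; unfold \<Psi>_def; intro \<phi>l)
  also have "\<dots> = \<Psi> a 1 1"
    by (rule sw_one; unfold \<Psi>_def; intro \<phi>l)
  finally show ?thesis by (simp add: \<Psi>_def)
qed

end

section \<open>Convolution of functionals and of bilinear forms\<close>

context bialgebra begin

lemma conv_eq_sw: "conv \<Delta> f h a = sw a (\<lambda>x y. f x * h y)"
  by (simp add: conv_def sw_def)

lemma lin_conv: "lin f \<Longrightarrow> lin h \<Longrightarrow> lin (conv \<Delta> f h)"
  unfolding conv_eq_sw by (intro lins)

lemma conv_assoc:
  assumes "lin f" "lin h" "lin k"
  shows "conv \<Delta> (conv \<Delta> f h) k = conv \<Delta> f (conv \<Delta> h k)"
proof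
  fix a
  have "sw a (\<lambda>x y. sw x (\<lambda>u v. f u * h v * k y)) = sw a (\<lambda>x y. sw y (\<lambda>u v. f x * h u * k v))"
    by (rule coassoc_sw; intro lins assms)
  then show "conv \<Delta> (conv \<Delta> f h) k a = conv \<Delta> f (conv \<Delta> h k) a"
    by (simp add: conv_eq_sw sw_mult_left mult.assoc flip: sw_mult_right)
qed

lemma conv_counit_left: "lin f \<Longrightarrow> conv \<Delta> \<epsilon> f = f"
  and conv_counit_right: "lin f \<Longrightarrow> conv \<Delta> f \<epsilon> = f"
  by (simp_all add: fun_eq_iff conv_eq_sw counit_left_sw counit_right_sw mult.commute[of _ "\<epsilon> _"])

lemma conv_inv_eqI:
  assumes "lin f" and inv: "is_conv_inverse scale \<Delta> \<epsilon> f h"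
  shows "conv_inv scale \<Delta> \<epsilon> f = h"
  unfolding conv_inv_def
proof (rule the_equality)
  show "is_conv_inverse scale \<Delta> \<epsilon> f h" by (rule inv)
next
  fix k assume "is_conv_inverse scale \<Delta> \<epsilon> f k"
  with inv have "lin h" "lin k" "conv \<Delta> h f = \<epsilon>" "conv \<Delta> f k = \<epsilon>"
    by (simp_all add: is_conv_inverse_def lin_iff_dual_space)
  then show "k = h"
    using conv_assoc[of h f k] \<open>lin f\<close> by (simp add: conv_counit_left conv_counit_right)
qed

text \<open>The convolution of the tensor product coalgebra, on bilinear forms; its unit is \<open>unit2\<close>.\<close>

definition conv2 :: "('a \<Rightarrow> 'a \<Rightarrow> 'k) \<Rightarrow> ('a \<Rightarrow> 'a \<Rightarrow> 'k) \<Rightarrow> 'a \<Rightarrow> 'a \<Rightarrow> 'k" where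
  "conv2 p q a b = sw a (\<lambda>x y. sw b (\<lambda>u v. p x u * q y v))"

definition unit2 :: "'a \<Rightarrow> 'a \<Rightarrow> 'k" where
  "unit2 a b = \<epsilon> a * \<epsilon> b"

lemma bilin_conv2:
  assumes "bilin p" "bilin q"
  shows "bilin (conv2 p q)"
  unfolding conv2_def
  by (intro lins lin_bilin_left[OF assms(1)] lin_bilin_right[OF assms(1)]
      lin_bilin_left[OF assms(2)] lin_bilin_right[OF assms(2)])

lemma bilin_unit2: "bilin unit2"
  unfolding unit2_def by (intro lins)

lemma conv2_assoc:
  assumes "bilin p" "bilin q" "bilin w"
  shows "conv2 (conv2 p q) w = conv2 p (conv2 q w)"
proof (intro ext)
  fix a b
  note pqw = lins lin_bilin_left[OF assms(1)] lin_bilin_right[OF assms(1)]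
    lin_bilin_left[OF assms(2)] lin_bilin_right[OF assms(2)]
    lin_bilin_left[OF assms(3)] lin_bilin_right[OF assms(3)]
  have "conv2 (conv2 p q) w a b =
      sw a (\<lambda>x y. sw b (\<lambda>u v. sw x (\<lambda>x1 x2. sw u (\<lambda>u1 u2. p x1 u1 * (q x2 u2 * w y v)))))"
    by (simp add: conv2_def mult.assoc flip: sw_mult_right)
  also have "\<dots> = sw a (\<lambda>x y. sw x (\<lambda>x1 x2. sw b (\<lambda>u v. sw u (\<lambda>u1 u2. p x1 u1 * (q x2 u2 * w y v)))))"
    by (rule sw_cong, rule sw_swap)
  also have "\<dots> = sw a (\<lambda>x y. sw y (\<lambda>y1 y2. sw b (\<lambda>u v. sw u (\<lambda>u1 u2. p x u1 * (q y1 u2 * w y2 v)))))"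
    by (rule coassoc_sw; intro pqw)
  also have "\<dots> = sw a (\<lambda>x y. sw y (\<lambda>y1 y2. sw b (\<lambda>u v. sw v (\<lambda>v1 v2. p x u * (q y1 v1 * w y2 v2)))))"
    by (rule sw_cong, rule sw_cong, rule coassoc_sw; intro pqw)
  also have "\<dots> = sw a (\<lambda>x y. sw b (\<lambda>u v. sw y (\<lambda>y1 y2. sw v (\<lambda>v1 v2. p x u * (q y1 v1 * w y2 v2)))))"
    by (rule sw_cong, rule sw_swap)
  also have "\<dots> = conv2 p (conv2 q w) a b"
    by (simp add: conv2_def sw_mult_left)
  finally show "conv2 (conv2 p q) w a b = conv2 p (conv2 q w) a b" .
qed

lemma conv2_unit_left:
  assumes "bilin w"
  shows "conv2 unit2 w = w"
proof (intro ext)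
  fix a b
  have "conv2 unit2 w a b = sw a (\<lambda>x y. \<epsilon> x * sw b (\<lambda>u v. \<epsilon> u * w y v))"
    by (simp add: conv2_def unit2_def mult.assoc sw_mult_left)
  also have "\<dots> = sw a (\<lambda>x y. \<epsilon> x * w y b)"
    using assms by (simp add: counit_left_sw bilin_def)
  also have "\<dots> = w a b"
    using assms by (simp add: counit_left_sw bilin_def)
  finally show "conv2 unit2 w a b = w a b" .
qed

lemma conv2_unit_right:
  assumes "bilin w"
  shows "conv2 w unit2 = w"
proof (intro ext)
  fix a b
  have "conv2 w unit2 a b = sw a (\<lambda>x y. \<epsilon> y * sw b (\<lambda>u v. \<epsilon> v * w x u))"
    by (simp add: conv2_def unit2_def mult_ac flip: sw_mult_left)
  also have "\<dots> = sw a (\<lambda>x y. \<epsilon> y * w x b)"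
    using assms by (simp add: counit_right_sw bilin_def)
  also have "\<dots> = w a b"
    using assms by (simp add: counit_right_sw bilin_def)
  finally show "conv2 w unit2 a b = w a b" .
qed

lemma conv2_inverse_unique:
  assumes "bilin w" "bilin p" "bilin q" and "conv2 q p = unit2" "conv2 p w = unit2"
  shows "w = q"
  using conv2_assoc[of q p w] assms by (simp add: conv2_unit_left conv2_unit_right)

lemma conv2_flip: "conv2 (\<lambda>a b. p b a) (\<lambda>a b. q b a) = (\<lambda>a b. conv2 p q b a)"
  unfolding conv2_def by (intro ext) (rule sw_swap)

lemma conv2_tensor:
  "conv2 (\<lambda>a b. f a * h b) (\<lambda>a b. f' a * h' b) = (\<lambda>a b. conv \<Delta> f f' a * conv \<Delta> h h' b)"
proof (intro ext)
  fix a b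
  have "conv2 (\<lambda>a b. f a * h b) (\<lambda>a b. f' a * h' b) a b =
      sw a (\<lambda>x y. sw b (\<lambda>u v. (f x * f' y) * (h u * h' v)))"
    by (simp add: conv2_def mult_ac)
  then show "conv2 (\<lambda>a b. f a * h b) (\<lambda>a b. f' a * h' b) a b = conv \<Delta> f f' a * conv \<Delta> h h' b"
    by (simp add: conv_eq_sw sw_mult_left flip: sw_mult_right)
qed

text \<open>The comultiplication is multiplicative, so pulling functionals back along the product is a
  homomorphism to bilinear forms.\<close>

lemma conv2_mult:
  assumes "lin f" "lin h"
  shows "conv2 (\<lambda>a b. f (a * b)) (\<lambda>a b. h (a * b)) = (\<lambda>a b. conv \<Delta> f h (a * b))"
  unfolding conv2_def conv_eq_sw
  by (intro ext, rule sw_mult[symmetric]) (intro lins lin_compose[OF assms(1)] lin_compose[OF assms(2)])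

end

section \<open>Universal r-forms as bilinear forms\<close>

text \<open>The axioms of a universal r-form \<open>p\<close> with convolution inverse \<open>q\<close>, in terms of bilinear forms.
  The commutation rule is an identity in the algebra and is tested against functionals.  Carrying
  \<open>q\<close> along makes the passage to the second r-form a symmetry that exchanges the two parameters
  up to a flip.\<close>

locale hopf_r_form = hopf_algebra scale \<Delta> \<epsilon> S
  for scale :: "'k::field \<Rightarrow> 'a::ring_1 \<Rightarrow> 'a"
    and \<Delta> :: "'a \<Rightarrow> ('a, 'k) tensor2"
    and \<epsilon> :: "'a \<Rightarrow> 'k"
    and S :: "'a \<Rightarrow> 'a" +
  fixes p q :: "'a \<Rightarrow> 'a \<Rightarrow> 'k"
  assumes bilin_p: "bilin p" and bilin_q: "bilin q"
    and conv2_p_q: "conv2 p q = unit2" and conv2_q_p: "conv2 q p = unit2"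
    and p_mult_right: "p c (a * b) = sw c (\<lambda>x y. p x b * p y a)"
    and p_mult_left: "p (a * b) c = sw c (\<lambda>x y. p a x * p b y)"
    and p_commutation: "lin h \<Longrightarrow>
      sw a (\<lambda>x y. sw b (\<lambda>u v. p x u * h (y * v))) = sw a (\<lambda>x y. sw b (\<lambda>u v. p y v * h (u * x)))"
begin

lemmas r_lins = S_lins
  lin_bilin_left[OF bilin_p] lin_bilin_right[OF bilin_p]
  lin_bilin_left[OF bilin_q] lin_bilin_right[OF bilin_q]

text \<open>\<open>p 1\<close> is idempotent for convolution because \<open>1 \<cdot> 1 = 1\<close>, and it is invertible with inverse
  \<open>q 1\<close>.\<close>

lemma p_one_left: "p 1 b = \<epsilon> b"
proof -
  have u: "lin (p 1)" and w: "lin (q 1)"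
    using bilin_p bilin_q by (simp_all add: bilin_def)
  have "conv \<Delta> (p 1) (p 1) = p 1"
    by (simp add: fun_eq_iff conv_eq_sw flip: p_mult_left)
  moreover have "conv \<Delta> (p 1) (q 1) = \<epsilon>"
  proof
    fix b
    have "conv \<Delta> (p 1) (q 1) b = conv2 p q 1 b"
      unfolding conv2_def by (subst sw_one) (intro r_lins, simp add: conv_eq_sw)
    then show "conv \<Delta> (p 1) (q 1) b = \<epsilon> b"
      by (simp add: conv2_p_q unit2_def counit_one)
  qed
  ultimately have "p 1 = \<epsilon>"
    using conv_assoc[OF u u w] by (simp add: conv_counit_right[OF u])
  then show ?thesis by simp
qed

text \<open>\<open>p(a\<^sub>1, b\<^sub>1) p(S(a\<^sub>2), b\<^sub>2) = p(a\<^sub>1 S(a\<^sub>2), b)\<close>, so the left hand side is a right inverse of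
  \<open>p\<close>.\<close>

lemma p_antipode_left: "p (S a) b = q a b"
proof -
  have bil: "bilin (\<lambda>a b. p (S a) b)"
    by (intro r_lins)
  have "conv2 p (\<lambda>a b. p (S a) b) = unit2"
  proof (intro ext)
    fix a b
    have "conv2 p (\<lambda>a b. p (S a) b) a b = sw a (\<lambda>x y. p (x * S y) b)"
      by (simp add: conv2_def p_mult_left)
    also have "\<dots> = \<epsilon> a * p 1 b"
      by (rule antipode_right_sw) (intro r_lins)
    finally show "conv2 p (\<lambda>a b. p (S a) b) a b = unit2 a b"
      by (simp add: p_one_left unit2_def)
  qed
  then have "(\<lambda>a b. p (S a) b) = q"
    by (rule conv2_inverse_unique[OF bil bilin_p bilin_q conv2_q_p])
  then show ?thesis by meson
qed

lemma q_mult_right: "q c (a * b) = sw c (\<lambda>x y. q x a * q y b)"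
proof -
  have "q c (a * b) = sw (S c) (\<lambda>x y. p x b * p y a)"
    by (simp add: p_mult_right flip: p_antipode_left)
  also have "\<dots> = sw c (\<lambda>x y. p (S y) b * p (S x) a)"
    by (rule sw_antipode) (intro r_lins)
  finally show ?thesis by (simp add: p_antipode_left mult.commute)
qed

lemma q_mult_left: "q (a * b) c = sw c (\<lambda>x y. q b x * q a y)"
  by (simp add: p_mult_left antipode_mult flip: p_antipode_left)

text \<open>Multiplying the commutation rule for \<open>p\<close> by \<open>q\<close> from both sides moves \<open>q\<close> across the
  product instead.\<close>

lemma q_commutation:
  assumes h: "lin h"
  shows "sw a (\<lambda>x y. sw b (\<lambda>u v. q y v * h (x * u))) = sw a (\<lambda>x y. sw b (\<lambda>u v. q x u * h (v * y)))"
proof -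
  note hl = lin_compose[OF h] lins
  define M where "M a b = h (a * b)" for a b
  define N where "N a b = h (b * a)" for a b
  have M: "bilin M" and N: "bilin N"
    unfolding M_def N_def by (intro hl)+
  have pM: "conv2 p M = conv2 N p"
    using p_commutation[OF h] by (simp add: fun_eq_iff conv2_def M_def N_def mult.commute)
  have "conv2 M q = conv2 (conv2 (conv2 q p) M) q"
    by (simp add: conv2_q_p conv2_unit_left M)
  also have "\<dots> = conv2 q (conv2 (conv2 p M) q)"
    by (simp add: conv2_assoc bilin_conv2 bilin_p bilin_q M)
  also have "\<dots> = conv2 q (conv2 N (conv2 p q))"
    unfolding pM by (simp add: conv2_assoc bilin_conv2 bilin_p bilin_q N)
  also have "\<dots> = conv2 q N"
    by (simp add: conv2_p_q conv2_unit_right N)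
  finally have "conv2 M q a b = conv2 q N a b" by simp
  then show ?thesis
    by (simp add: conv2_def M_def N_def mult.commute)
qed

text \<open>The second r-form of the theorem.  Every later result on \<open>p\<close> therefore also holds for it.\<close>

lemma flipped_inverse_r_form: "hopf_r_form scale \<Delta> \<epsilon> S (\<lambda>a b. q b a) (\<lambda>a b. p b a)"
proof unfold_locales
  show "bilin (\<lambda>a b. q b a)" "bilin (\<lambda>a b. p b a)"
    by (intro r_lins)+
  have "(\<lambda>a b. unit2 b a) = unit2"
    by (simp add: unit2_def fun_eq_iff mult.commute)
  then show "conv2 (\<lambda>a b. q b a) (\<lambda>a b. p b a) = unit2"
    and "conv2 (\<lambda>a b. p b a) (\<lambda>a b. q b a) = unit2"
    using conv2_flip[of q p] conv2_flip[of p q] by (simp_all only: conv2_p_q conv2_q_p)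
  show "q (a * b) c = sw c (\<lambda>x y. q b x * q a y)" for a b c
    by (rule q_mult_left)
  show "q c (a * b) = sw c (\<lambda>x y. q x a * q y b)" for a b c
    by (rule q_mult_right)
  show "sw a (\<lambda>x y. sw b (\<lambda>u v. q u x * h (y * v))) = sw a (\<lambda>x y. sw b (\<lambda>u v. q v y * h (u * x)))"
    if "lin h" for h a b
    using q_commutation[OF that, of b a] by (subst (1 2) sw_swap) simp
qed

text \<open>This is \<open>p_antipode_left\<close> for the flipped inverse.\<close>

lemma q_antipode_right: "q a (S b) = p a b"
proof -
  interpret flipped: hopf_r_form scale \<Delta> \<epsilon> S "\<lambda>a b. q b a" "\<lambda>a b. p b a"
    by (rule flipped_inverse_r_form)
  show ?thesis by (rule flipped.p_antipode_left)
qed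

lemma p_antipode_antipode: "p (S a) (S b) = p a b"
  by (simp add: p_antipode_left q_antipode_right)

lemma q_antipode_antipode: "q (S a) (S b) = q a b"
  by (simp add: p_antipode_left q_antipode_right)

section \<open>The functional of an r-form and the square of the antipode\<close>

definition f :: "'a \<Rightarrow> 'k" where
  "f a = sw a (\<lambda>x y. p x (S y))"

definition fbar :: "'a \<Rightarrow> 'k" where
  "fbar a = sw a (\<lambda>x y. q (S x) y)"

lemma lin_f: "lin f" and lin_fbar: "lin fbar"
  unfolding f_def fbar_def by (intro r_lins)+

lemmas f_lins = r_lins lin_compose[OF lin_f] lin_compose[OF lin_fbar]

text \<open>The dual identity is \<open>h\<^sub>2 v S(h\<^sub>1) = \<epsilon>(h) v\<close>.  Evaluate the commutation rule at \<open>a\<^sub>1\<close> and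
  \<open>S(a\<^sub>2)\<close>: on one side the two arguments of \<open>h\<close> cancel and leave \<open>f(a)\<close>, on the other side the
  arguments of \<open>p\<close> are adjacent and form \<open>f(a\<^sub>2)\<close>.\<close>

lemma f_antipode_absorb:
  assumes h: "lin h"
  shows "sw a (\<lambda>x y. sw y (\<lambda>u v. f u * h (S v * x))) = f a * h 1"
proof -
  note hl = lin_compose[OF h] f_lins
  have "sw a (\<lambda>x y. sw y (\<lambda>u v. f u * h (S v * x))) =
      sw a (\<lambda>x y. sw y (\<lambda>u v. sw u (\<lambda>u1 u2. p u1 (S u2) * h (S v * x))))"
    by (simp add: f_def sw_mult_right)
  also have "\<dots> = sw a (\<lambda>x y. sw x (\<lambda>x1 x2. sw y (\<lambda>y1 y2. p x2 (S y1) * h (S y2 * x1))))"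
    by (rule coassoc4_sw[symmetric]; intro hl)
  also have "\<dots> = sw a (\<lambda>x y. sw x (\<lambda>x1 x2. sw (S y) (\<lambda>w1 w2. p x2 w2 * h (w1 * x1))))"
    by (rule sw_cong, rule sw_cong, rule sw_antipode[symmetric]) (intro hl)
  also have "\<dots> = sw a (\<lambda>x y. sw x (\<lambda>x1 x2. sw (S y) (\<lambda>w1 w2. p x1 w1 * h (x2 * w2))))"
    by (simp add: p_commutation[OF h])
  also have "\<dots> = sw a (\<lambda>x y. sw x (\<lambda>x1 x2. sw y (\<lambda>y1 y2. p x1 (S y2) * h (x2 * S y1))))"
    by (rule sw_cong, rule sw_cong, rule sw_antipode) (intro hl)
  also have "\<dots> = sw a (\<lambda>x y. sw y (\<lambda>u v. sw u (\<lambda>u1 u2. p x (S v) * h (u1 * S u2))))"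
    by (rule coassoc4_sw; intro hl)
  also have "\<dots> = sw a (\<lambda>x y. sw y (\<lambda>u v. \<epsilon> u * (p x (S v) * h 1)))"
    by (simp add: sw_mult_left antipode_right_sw[OF h] mult_ac)
  also have "\<dots> = sw a (\<lambda>x y. p x (S y) * h 1)"
    by (rule sw_cong, rule counit_left_sw; intro hl)
  finally show ?thesis by (simp add: f_def sw_mult_right)
qed

text \<open>This is \<open>a\<^sub>1 f(a\<^sub>2) = f(a\<^sub>1) S\<^sup>2(a\<^sub>2)\<close>, or \<open>S\<^sup>2 = fbar * id * f\<close> once \<open>f\<close> is known to be invertible.
  Insert \<open>f_antipode_absorb\<close> behind \<open>S\<^sup>2(a\<^sub>2)\<close>; the factors \<open>S\<^sup>2(a\<^sub>4) S(a\<^sub>3) = S(a\<^sub>3 S(a\<^sub>4))\<close> then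
  cancel.\<close>

lemma f_antipode_square:
  assumes h: "lin h"
  shows "sw a (\<lambda>x y. f y * h x) = sw a (\<lambda>x y. f x * h (S (S y)))"
proof -
  note hl = lin_compose[OF h] f_lins
  have "sw a (\<lambda>x y. f x * h (S (S y))) =
      sw a (\<lambda>x y. sw x (\<lambda>x1 x2. sw x2 (\<lambda>u v. f u * h (S (S y) * (S v * x1)))))"
  proof (rule sw_cong)
    fix x y
    have "lin (\<lambda>w. h (S (S y) * w))" by (intro hl)
    from f_antipode_absorb[OF this, of x]
    show "f x * h (S (S y)) = sw x (\<lambda>x1 x2. sw x2 (\<lambda>u v. f u * h (S (S y) * (S v * x1))))"
      by simp
  qed
  also have "\<dots> = sw a (\<lambda>x t. sw t (\<lambda>x2 y. sw x2 (\<lambda>u v. f u * h (S (S y) * (S v * x)))))"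
    by (rule coassoc_sw; intro hl)
  also have "\<dots> = sw a (\<lambda>x t. sw t (\<lambda>u w. sw w (\<lambda>v y. f u * h (S (S y) * (S v * x)))))"
    by (rule sw_cong, rule coassoc_sw; intro hl)
  also have "\<dots> = sw a (\<lambda>x t. sw t (\<lambda>u w. sw w (\<lambda>v y. f u * h (S (v * S y) * x))))"
    by (simp add: antipode_mult mult.assoc)
  also have "\<dots> = sw a (\<lambda>x t. sw t (\<lambda>u w. \<epsilon> w * (f u * h (S 1 * x))))"
    by (rule sw_cong, rule sw_cong, rule antipode_right_sw; intro hl)
  also have "\<dots> = sw a (\<lambda>x t. f t * h (S 1 * x))"
    by (rule sw_cong, rule counit_right_sw; intro hl)
  finally show ?thesis by (simp add: antipode_one)
qed

text \<open>With \<open>f\<close> written out, the sum is \<open>q * p\<close> at \<open>(a\<^sub>1, S(a\<^sub>2))\<close>, the antipode having reversed the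
  order of the components of \<open>a\<^sub>2\<close>.  Both products of \<open>f\<close> and \<open>fbar\<close> reduce to it by moving \<open>f\<close>
  to the right place at the cost of \<open>S\<^sup>2\<close>.\<close>

lemma q_antipode_f_cancel: "sw a (\<lambda>x y. sw y (\<lambda>u v. q x (S v) * f u)) = \<epsilon> a"
proof -
  have "sw a (\<lambda>x y. sw y (\<lambda>u v. q x (S v) * f u)) =
      sw a (\<lambda>x y. sw y (\<lambda>u v. sw u (\<lambda>u1 u2. q x (S v) * p u1 (S u2))))"
    by (simp add: f_def sw_mult_left)
  also have "\<dots> = sw a (\<lambda>x y. sw x (\<lambda>x1 x2. sw y (\<lambda>y1 y2. q x1 (S y2) * p x2 (S y1))))"
    by (rule coassoc4_sw[symmetric]; intro f_lins)
  also have "\<dots> = sw a (\<lambda>x y. sw x (\<lambda>x1 x2. sw (S y) (\<lambda>w1 w2. q x1 w1 * p x2 w2)))"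
    by (rule sw_cong, rule sw_cong, rule sw_antipode[symmetric]) (intro f_lins)
  also have "\<dots> = sw a (\<lambda>x y. \<epsilon> x * \<epsilon> y)"
    using conv2_q_p by (simp add: fun_eq_iff conv2_def unit2_def counit_antipode)
  also have "\<dots> = \<epsilon> a"
    by (rule counit_left_sw[OF lin_counit])
  finally show ?thesis .
qed

lemma f_conv_fbar: "conv \<Delta> f fbar = \<epsilon>"
proof
  fix a
  have "conv \<Delta> f fbar a = sw a (\<lambda>x y. sw y (\<lambda>u v. f x * q (S (S u)) (S v)))"
    by (simp add: conv_eq_sw fbar_def sw_mult_left q_antipode_antipode)
  also have "\<dots> = sw a (\<lambda>m v. sw m (\<lambda>x u. f x * q (S (S u)) (S v)))"
    by (rule coassoc_sw[symmetric]; intro f_lins)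
  also have "\<dots> = sw a (\<lambda>m v. sw m (\<lambda>x u. f u * q x (S v)))"
    by (rule sw_cong, rule f_antipode_square[symmetric]) (intro f_lins)
  also have "\<dots> = sw a (\<lambda>x y. sw y (\<lambda>u v. f u * q x (S v)))"
    by (rule coassoc_sw; intro f_lins)
  finally show "conv \<Delta> f fbar a = \<epsilon> a"
    by (simp add: q_antipode_f_cancel mult.commute)
qed

lemma fbar_conv_f: "conv \<Delta> fbar f = \<epsilon>"
proof
  fix a
  have "conv \<Delta> fbar f a = sw a (\<lambda>x y. f y * fbar x)"
    by (simp add: conv_eq_sw mult.commute)
  also have "\<dots> = sw a (\<lambda>x y. sw x (\<lambda>x1 x2. f y * q (S x1) x2))"
    by (simp add: fbar_def sw_mult_left)
  also have "\<dots> = sw a (\<lambda>x y. sw y (\<lambda>u v. f v * q (S x) u))"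
    by (rule coassoc_sw; intro f_lins)
  also have "\<dots> = sw a (\<lambda>x y. sw y (\<lambda>u v. f u * q (S x) (S (S v))))"
    by (rule sw_cong, rule f_antipode_square) (intro f_lins)
  finally show "conv \<Delta> fbar f a = \<epsilon> a"
    by (simp add: q_antipode_antipode q_antipode_f_cancel mult.commute)
qed

lemma f_inverse: "is_conv_inverse scale \<Delta> \<epsilon> f fbar"
  using lin_fbar by (simp add: is_conv_inverse_def f_conv_fbar fbar_conv_f lin_iff_dual_space)

lemma conv_f_right: "lin h \<Longrightarrow> conv \<Delta> h f = conv \<Delta> f (\<lambda>x. h (S (S x)))"
  using f_antipode_square by (simp add: fun_eq_iff conv_eq_sw mult.commute)

text \<open>The antipode reverses \<open>a\<^sub>1 \<otimes> a\<^sub>2\<close> twice, and \<open>p\<close> is invariant under \<open>S \<otimes> S\<close>.\<close>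

lemma f_antipode_square_invariant: "f (S (S a)) = f a"
proof -
  have "f (S b) = sw b (\<lambda>x y. p (S y) (S (S x)))" for b
    unfolding f_def by (rule sw_antipode) (intro f_lins)
  then have "f (S (S a)) = sw (S a) (\<lambda>x y. p y (S x))"
    by (simp add: p_antipode_antipode)
  also have "\<dots> = sw a (\<lambda>x y. p (S x) (S (S y)))"
    by (rule sw_antipode) (intro f_lins)
  finally show ?thesis by (simp add: p_antipode_antipode f_def)
qed

text \<open>The dual of \<open>\<Delta>(v) = (R\<^sub>2\<^sub>1 R)\<^sup>-\<^sup>1 (v \<otimes> v)\<close>.  Expand \<open>p(a\<^sub>1 b\<^sub>1, S(b\<^sub>2) S(a\<^sub>2))\<close> in its second
  argument, and then in the first argument the factor that contains \<open>S(b\<^sub>2)\<close>.  An inner pair forms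
  \<open>f\<close>, and \<open>f_antipode_square\<close> exchanges this \<open>f\<close> with the neighbouring \<open>p(y, S(t)) = q(y, S\<^sup>2(t))\<close>,
  which turns it into a factor \<open>q\<close> without antipode.  The commutation rule for \<open>q\<close> reverses the
  product in the remaining factor \<open>p(\<cdot>, S(a\<^sub>2))\<close>, and the same two steps in the variable \<open>a\<close> finish.\<close>

lemma f_mult: "(\<lambda>a b. f (a * b)) = conv2 q (conv2 (\<lambda>a b. q b a) (\<lambda>a b. f a * f b))"
proof (intro ext)
  fix a b
  \<comment> \<open>the exchange of \<open>f\<close> with a neighbouring factor, used once for \<open>b\<close> and once for \<open>a\<close>\<close>
  have slide: "sw w (\<lambda>m t. f m * p y (S t)) = sw w (\<lambda>m t. f t * q y m)" for w y
  proof -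
    have "lin (q y)" using bilin_q by (simp add: bilin_def)
    from f_antipode_square[OF this, of w] show ?thesis by (simp add: q_antipode_right)
  qed
  have "f (a * b) = sw a (\<lambda>a1 a2. sw b (\<lambda>b1 b2. p (a1 * b1) (S b2 * S a2)))"
    unfolding f_def by (subst sw_mult) (intro f_lins, simp add: antipode_mult)
  also have "\<dots> = sw a (\<lambda>a1 a2. sw b (\<lambda>b1 b2. sw a1 (\<lambda>x y. sw b1 (\<lambda>u v.
      p (x * u) (S a2) * p (y * v) (S b2)))))"
    unfolding p_mult_right[of "_ * _"] by (rule sw_cong, rule sw_cong, rule sw_mult) (intro f_lins)
  also have "\<dots> = sw a (\<lambda>a1 a2. sw a1 (\<lambda>x y. sw b (\<lambda>b1 b2. sw b1 (\<lambda>u v.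
      p (x * u) (S a2) * p (y * v) (S b2)))))"
    by (rule sw_cong, rule sw_swap)
  also have "\<dots> = sw a (\<lambda>a1 a2. sw a1 (\<lambda>x y. sw b (\<lambda>b1 b2. sw b1 (\<lambda>u v. sw b2 (\<lambda>s t.
      p (x * u) (S a2) * (p y (S t) * p v (S s)))))))"
  proof (intro sw_cong)
    fix a2 x y b2 u v
    have "p (y * v) (S b2) = sw b2 (\<lambda>s t. p y (S t) * p v (S s))"
      unfolding p_mult_left by (rule sw_antipode) (intro f_lins)
    then show "p (x * u) (S a2) * p (y * v) (S b2) =
        sw b2 (\<lambda>s t. p (x * u) (S a2) * (p y (S t) * p v (S s)))"
      by (simp add: sw_mult_left)
  qed
  \<comment> \<open>now \<open>v\<close> and \<open>s\<close> are adjacent and \<open>p v (S s)\<close> sums to \<open>f m\<close>\<close>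
  also have "\<dots> = sw a (\<lambda>a1 a2. sw a1 (\<lambda>x y. sw b (\<lambda>u w. sw w (\<lambda>m t. sw m (\<lambda>v s.
      p (x * u) (S a2) * (p y (S t) * p v (S s)))))))"
    by (rule sw_cong, rule sw_cong, rule coassoc4_sw; intro f_lins)
  also have "\<dots> = sw a (\<lambda>a1 a2. sw a1 (\<lambda>x y. sw b (\<lambda>u w. sw w (\<lambda>m t.
      f t * (q y m * p (x * u) (S a2))))))"
  proof (rule sw_cong, rule sw_cong, rule sw_cong)
    fix a2 x y u w
    have "sw w (\<lambda>m t. sw m (\<lambda>v s. p (x * u) (S a2) * (p y (S t) * p v (S s)))) =
        p (x * u) (S a2) * sw w (\<lambda>m t. p y (S t) * f m)"
      by (simp add: sw_mult_left f_def)
    also have "\<dots> = p (x * u) (S a2) * sw w (\<lambda>m t. f m * p y (S t))"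
      by (simp add: mult.commute)
    also have "\<dots> = sw w (\<lambda>m t. f t * (q y m * p (x * u) (S a2)))"
      unfolding slide by (simp add: mult_ac flip: sw_mult_left)
    finally show "sw w (\<lambda>m t. sw m (\<lambda>v s. p (x * u) (S a2) * (p y (S t) * p v (S s)))) =
        sw w (\<lambda>m t. f t * (q y m * p (x * u) (S a2)))" .
  qed
  also have "\<dots> = sw a (\<lambda>a1 a2. sw a1 (\<lambda>x y. sw b (\<lambda>b1 t. sw b1 (\<lambda>u m.
      f t * (q y m * p (x * u) (S a2))))))"
    by (rule sw_cong, rule sw_cong, rule coassoc_sw[symmetric]; intro f_lins)
  also have "\<dots> = sw a (\<lambda>a1 a2. sw b (\<lambda>b1 t. f t * sw a1 (\<lambda>x y. sw b1 (\<lambda>u m.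
      q y m * p (x * u) (S a2)))))"
    unfolding sw_mult_left[symmetric] by (rule sw_cong, rule sw_swap)
  also have "\<dots> = sw a (\<lambda>a1 a2. sw b (\<lambda>b1 t. f t * sw a1 (\<lambda>x y. sw b1 (\<lambda>u m.
      q x u * p (m * y) (S a2)))))"
  proof (rule sw_cong, rule sw_cong, rule arg_cong[where f = "\<lambda>z. f _ * z"])
    fix a1 a2 b1
    have "lin (\<lambda>z. p z (S a2))" by (intro f_lins)
    then show "sw a1 (\<lambda>x y. sw b1 (\<lambda>u m. q y m * p (x * u) (S a2))) =
        sw a1 (\<lambda>x y. sw b1 (\<lambda>u m. q x u * p (m * y) (S a2)))"
      by (rule q_commutation)
  qed
  also have "\<dots> = sw b (\<lambda>b1 t. sw b1 (\<lambda>u m. sw a (\<lambda>a1 a2. sw a1 (\<lambda>x y.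
      f t * (q x u * p (m * y) (S a2))))))"
  proof -
    have "sw a (\<lambda>a1 a2. sw b (\<lambda>b1 t. f t * sw a1 (\<lambda>x y. sw b1 (\<lambda>u m.
        q x u * p (m * y) (S a2))))) =
      sw b (\<lambda>b1 t. sw a (\<lambda>a1 a2. sw a1 (\<lambda>x y. sw b1 (\<lambda>u m.
        f t * (q x u * p (m * y) (S a2))))))"
      unfolding sw_mult_left[symmetric] by (rule sw_swap)
    also have "\<dots> = sw b (\<lambda>b1 t. sw a (\<lambda>a1 a2. sw b1 (\<lambda>u m. sw a1 (\<lambda>x y.
        f t * (q x u * p (m * y) (S a2))))))"
      by (rule sw_cong, rule sw_cong, rule sw_swap)
    also have "\<dots> = sw b (\<lambda>b1 t. sw b1 (\<lambda>u m. sw a (\<lambda>a1 a2. sw a1 (\<lambda>x y.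
        f t * (q x u * p (m * y) (S a2))))))"
      by (rule sw_cong, rule sw_swap)
    finally show ?thesis .
  qed
  \<comment> \<open>the variable \<open>a\<close> is treated like \<open>b\<close> before\<close>
  also have "\<dots> = sw b (\<lambda>b1 t. sw b1 (\<lambda>u m. sw a (\<lambda>x w. sw w (\<lambda>n z.
      f t * (f z * (q x u * q m n))))))"
  proof (rule sw_cong, rule sw_cong)
    fix t u m
    have "sw a (\<lambda>a1 a2. sw a1 (\<lambda>x y. f t * (q x u * p (m * y) (S a2)))) =
      sw a (\<lambda>a1 a2. sw a1 (\<lambda>x y. sw a2 (\<lambda>s z. f t * (q x u * (p m (S z) * p y (S s))))))"
    proof (intro sw_cong)
      fix x y a2
      have "p (m * y) (S a2) = sw a2 (\<lambda>s z. p m (S z) * p y (S s))"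
        unfolding p_mult_left by (rule sw_antipode) (intro f_lins)
      then show "f t * (q x u * p (m * y) (S a2)) =
          sw a2 (\<lambda>s z. f t * (q x u * (p m (S z) * p y (S s))))"
        by (simp add: sw_mult_left)
    qed
    also have "\<dots> = sw a (\<lambda>x w. sw w (\<lambda>n z. sw n (\<lambda>y s. f t * (q x u * (p m (S z) * p y (S s))))))"
      by (rule coassoc4_sw; intro f_lins)
    also have "\<dots> = sw a (\<lambda>x w. f t * (q x u * sw w (\<lambda>n z. p m (S z) * f n)))"
      by (simp add: sw_mult_left f_def)
    also have "\<dots> = sw a (\<lambda>x w. f t * (q x u * sw w (\<lambda>n z. f n * p m (S z))))"
      by (simp add: mult.commute)
    also have "\<dots> = sw a (\<lambda>x w. sw w (\<lambda>n z. f t * (f z * (q x u * q m n))))"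
      unfolding slide by (simp add: mult_ac flip: sw_mult_left)
    finally show "sw a (\<lambda>a1 a2. sw a1 (\<lambda>x y. f t * (q x u * p (m * y) (S a2)))) =
      sw a (\<lambda>x w. sw w (\<lambda>n z. f t * (f z * (q x u * q m n))))" .
  qed
  also have "\<dots> = sw b (\<lambda>u b'. sw b' (\<lambda>m t. sw a (\<lambda>x w. sw w (\<lambda>n z.
      f t * (f z * (q x u * q m n))))))"
    by (rule coassoc_sw; intro f_lins)
  also have "\<dots> = sw b (\<lambda>u b'. sw a (\<lambda>x w. sw b' (\<lambda>m t. sw w (\<lambda>n z.
      f t * (f z * (q x u * q m n))))))"
    by (rule sw_cong, rule sw_swap)
  also have "\<dots> = sw b (\<lambda>u b'. sw a (\<lambda>x w. sw w (\<lambda>n z. sw b' (\<lambda>m t.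
      f t * (f z * (q x u * q m n))))))"
    by (rule sw_cong, rule sw_cong, rule sw_swap)
  also have "\<dots> = sw a (\<lambda>x w. sw b (\<lambda>u b'. sw w (\<lambda>n z. sw b' (\<lambda>m t.
      f t * (f z * (q x u * q m n))))))"
    by (rule sw_swap)
  also have "\<dots> = conv2 q (conv2 (\<lambda>a b. q b a) (\<lambda>a b. f a * f b)) a b"
    by (simp add: conv2_def mult_ac flip: sw_mult_left)
  finally show "f (a * b) = conv2 q (conv2 (\<lambda>a b. q b a) (\<lambda>a b. f a * f b)) a b" .
qed

text \<open>The rule \<open>f_antipode_square\<close>, applied in both arguments.\<close>

lemma conv2_f_f_commutes:
  assumes w: "bilin w" and inv: "\<And>a b. w (S (S a)) (S (S b)) = w a b"
  shows "conv2 (\<lambda>a b. f a * f b) w = conv2 w (\<lambda>a b. f a * f b)"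
proof (intro ext)
  fix a b
  note wl = lin_bilin_left[OF w] lin_bilin_right[OF w] f_lins
  have "conv2 w (\<lambda>a b. f a * f b) a b = sw a (\<lambda>x y. sw b (\<lambda>u v. f v * (f y * w x u)))"
    by (simp add: conv2_def mult_ac)
  also have "\<dots> = sw a (\<lambda>x y. sw b (\<lambda>u v. f u * (f y * w x (S (S v)))))"
    by (rule sw_cong, rule f_antipode_square) (intro wl)
  also have "\<dots> = sw b (\<lambda>u v. sw a (\<lambda>x y. f y * (f u * w x (S (S v)))))"
    by (subst sw_swap) (simp add: mult_ac)
  also have "\<dots> = sw b (\<lambda>u v. sw a (\<lambda>x y. f x * (f u * w (S (S y)) (S (S v)))))"
    by (rule sw_cong, rule f_antipode_square) (intro wl)
  also have "\<dots> = conv2 (\<lambda>a b. f a * f b) w a b"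
    unfolding conv2_def inv by (subst sw_swap) (simp add: mult_ac)
  finally show "conv2 (\<lambda>a b. f a * f b) w a b = conv2 w (\<lambda>a b. f a * f b) a b" ..
qed

end

section \<open>An r-form and its flipped inverse\<close>

context hopf_algebra begin

lemma conv_inverse_commutes:
  assumes "lin f" "lin h" and inv: "is_conv_inverse scale \<Delta> \<epsilon> f k"
    and comm: "conv \<Delta> f h = conv \<Delta> h f"
  shows "conv \<Delta> k h = conv \<Delta> h k"
proof -
  have k: "lin k" "conv \<Delta> f k = \<epsilon>" "conv \<Delta> k f = \<epsilon>"
    using inv by (simp_all add: is_conv_inverse_def lin_iff_dual_space)
  have "conv \<Delta> k h = conv \<Delta> k (conv \<Delta> h (conv \<Delta> f k))"
    using assms k by (simp add: conv_counit_right)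
  also have "\<dots> = conv \<Delta> (conv \<Delta> k (conv \<Delta> f h)) k"
    using assms k by (simp add: conv_assoc lin_conv comm)
  also have "\<dots> = conv \<Delta> (conv \<Delta> (conv \<Delta> k f) h) k"
    by (simp only: conv_assoc[OF k(1) assms(1,2)])
  also have "\<dots> = conv \<Delta> h k"
    using assms k by (simp add: conv_counit_left)
  finally show ?thesis .
qed

text \<open>Tested against \<open>h\<close>, the map \<open>k * id * g\<close> becomes a product in the dual algebra.\<close>

lemma lin_conv_id_conv:
  assumes h: "lin h"
  shows "h (conv_id_conv scale \<Delta> k g a) = conv \<Delta> k (conv \<Delta> h g) a"
proof -
  have "h (conv_id_conv scale \<Delta> k g a) = sw a (\<lambda>x y. sw y (\<lambda>u v. h (scale (k x * g v) u)))"
    unfolding conv_id_conv_def sw_def lin_tensor_lift[OF h] ..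
  also have "\<dots> = sw a (\<lambda>x y. sw y (\<lambda>u v. k x * (h u * g v)))"
    using h by (simp add: lin_def mult_ac)
  finally show ?thesis
    by (simp add: conv_eq_sw sw_mult_left)
qed

end

text \<open>\<open>flipped.f\<close> and \<open>flipped.fbar\<close> are the functionals of the second r-form.\<close>

locale hopf_r_form_flipped = hopf_r_form scale \<Delta> \<epsilon> S p q +
    flipped: hopf_r_form scale \<Delta> \<epsilon> S "\<lambda>a b. q b a" "\<lambda>a b. p b a"
  for scale :: "'k::field \<Rightarrow> 'a::ring_1 \<Rightarrow> 'a"
    and \<Delta> :: "'a \<Rightarrow> ('a, 'k) tensor2"
    and \<epsilon> :: "'a \<Rightarrow> 'k"
    and S :: "'a \<Rightarrow> 'a"
    and p q :: "'a \<Rightarrow> 'a \<Rightarrow> 'k"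
begin

lemmas lin_all = lin_f lin_fbar flipped.lin_f flipped.lin_fbar lin_conv lin_counit

text \<open>\<open>conv_f_right\<close> moves \<open>flipped.f\<close> across \<open>f\<close> at the cost of \<open>S\<^sup>2\<close>, which fixes \<open>flipped.f\<close>.\<close>

lemma f_commutes_flipped_f: "conv \<Delta> flipped.f f = conv \<Delta> f flipped.f"
  using conv_f_right[OF flipped.lin_f] by (simp add: flipped.f_antipode_square_invariant)

lemma functionals_commute:
  assumes "h \<in> {f, fbar, flipped.f, flipped.fbar}" "k \<in> {f, fbar, flipped.f, flipped.fbar}"
  shows "conv \<Delta> h k = conv \<Delta> k h"
proof -
  note inv = conv_inverse_commutes[OF lin_f _ f_inverse]
    conv_inverse_commutes[OF flipped.lin_f _ flipped.f_inverse]
  have "conv \<Delta> fbar flipped.f = conv \<Delta> flipped.f fbar"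
    by (rule inv(1)[OF flipped.lin_f f_commutes_flipped_f[symmetric]])
  moreover have "conv \<Delta> flipped.fbar f = conv \<Delta> f flipped.fbar"
    by (rule inv(2)[OF lin_f f_commutes_flipped_f])
  moreover have "conv \<Delta> fbar flipped.fbar = conv \<Delta> flipped.fbar fbar"
    by (rule inv(1)[OF flipped.lin_fbar]) (use calculation in simp)
  ultimately show ?thesis
    using assms f_commutes_flipped_f
    by (auto simp: f_conv_fbar fbar_conv_f flipped.f_conv_fbar flipped.fbar_conv_f)
qed

text \<open>\<open>S\<^sup>2\<close> is conjugation by \<open>f\<close> and also conjugation by \<open>flipped.f\<close>.\<close>

lemma f_flipped_fbar_central:
  assumes h: "lin h"
  shows "conv \<Delta> (conv \<Delta> f flipped.fbar) h = conv \<Delta> h (conv \<Delta> f flipped.fbar)"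
proof -
  define h' where "h' = (\<lambda>x. h (S (S x)))"
  have h': "lin h'"
    unfolding h'_def by (intro lin_compose[OF h] S_lins)
  note lins' = h h' lin_all
  have "conv \<Delta> flipped.fbar h = conv \<Delta> (conv \<Delta> flipped.fbar (conv \<Delta> h flipped.f)) flipped.fbar"
    by (simp add: conv_assoc lins' flipped.f_conv_fbar conv_counit_right)
  also have "\<dots> = conv \<Delta> (conv \<Delta> (conv \<Delta> flipped.fbar flipped.f) h') flipped.fbar"
    unfolding flipped.conv_f_right[OF h, folded h'_def] by (simp add: conv_assoc lins')
  also have "\<dots> = conv \<Delta> h' flipped.fbar"
    by (simp add: flipped.fbar_conv_f conv_counit_left lins')
  finally have "conv \<Delta> (conv \<Delta> f flipped.fbar) h = conv \<Delta> (conv \<Delta> f h') flipped.fbar"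
    by (simp add: conv_assoc lins')
  then show ?thesis
    unfolding conv_f_right[OF h, folded h'_def, symmetric] by (simp add: conv_assoc lins')
qed

text \<open>The factors \<open>q\<close> and \<open>q'\<close> of \<open>f_mult\<close> are inverse to the factors \<open>p\<close> and \<open>p'\<close> of the same rule
  for the flipped form.  The form \<open>F\<close> between them commutes with \<open>p\<close> and \<open>p'\<close>, so they cancel.\<close>

lemma f_flipped_f_mult:
  "conv \<Delta> f flipped.f (a * b) = conv \<Delta> f flipped.f a * conv \<Delta> f flipped.f b"
proof -
  define p' q' F F' where "p' = (\<lambda>a b. p b a)" and "q' = (\<lambda>a b. q b a)"
    and "F = (\<lambda>a b. f a * f b)" and "F' = (\<lambda>a b. flipped.f a * flipped.f b)"
  have F_lins: "bilin F" "bilin F'"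
    unfolding F_def F'_def by (intro f_lins lin_compose[OF flipped.lin_f])+
  note bil = bilin_p bilin_q flipped.bilin_p[folded q'_def] flipped.bilin_q[folded p'_def] F_lins
    bilin_conv2
  have cancel: "conv2 q p = unit2" "conv2 q' p' = unit2"
    using conv2_q_p flipped.conv2_p_q by (simp_all add: p'_def q'_def)
  have Fp': "conv2 F p' = conv2 p' F" and Fp: "conv2 F p = conv2 p F"
    unfolding F_def p'_def
    by (rule conv2_f_f_commutes; simp add: bilin_p flipped.bilin_q p_antipode_antipode)+
  have F_p'_p: "conv2 F (conv2 p' (conv2 p F')) = conv2 p' (conv2 p (conv2 F F'))"
    using conv2_assoc[of F p' "conv2 p F'"] conv2_assoc[of p' F "conv2 p F'"]
      conv2_assoc[of F p F'] conv2_assoc[of p F F'] by (simp add: bil Fp' Fp)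
  have "(\<lambda>a b. conv \<Delta> f flipped.f (a * b)) = conv2 (conv2 q (conv2 q' F)) (conv2 p' (conv2 p F'))"
    unfolding conv2_mult[OF lin_f flipped.lin_f, symmetric] f_mult flipped.f_mult
    by (simp add: p'_def q'_def F_def F'_def)
  also have "\<dots> = conv2 q (conv2 q' (conv2 p' (conv2 p (conv2 F F'))))"
    by (simp add: conv2_assoc bil F_p'_p)
  also have "\<dots> = conv2 q (conv2 p (conv2 F F'))"
    using conv2_assoc[of q' p' "conv2 p (conv2 F F')"] by (simp add: bil cancel conv2_unit_left)
  also have "\<dots> = conv2 F F'"
    using conv2_assoc[of q p "conv2 F F'"] by (simp add: bil cancel conv2_unit_left)
  also have "\<dots> = (\<lambda>a b. conv \<Delta> f flipped.f a * conv \<Delta> f flipped.f b)"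
    unfolding F_def F'_def by (rule conv2_tensor)
  finally show ?thesis by meson
qed

lemma f_flipped_f_inverse:
  "is_conv_inverse scale \<Delta> \<epsilon> (conv \<Delta> f flipped.f) (conv \<Delta> flipped.fbar fbar)"
proof -
  have "conv \<Delta> (conv \<Delta> f flipped.f) (conv \<Delta> flipped.fbar fbar) =
      conv \<Delta> f (conv \<Delta> (conv \<Delta> flipped.f flipped.fbar) fbar)"
    by (simp add: conv_assoc lin_all)
  moreover have "conv \<Delta> (conv \<Delta> flipped.fbar fbar) (conv \<Delta> f flipped.f) =
      conv \<Delta> flipped.fbar (conv \<Delta> (conv \<Delta> fbar f) flipped.f)"
    by (simp add: conv_assoc lin_all)
  ultimately show ?thesis
    by (simp add: is_conv_inverse_def lin_all conv_counit_left f_conv_fbar fbar_conv_f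
        flipped.f_conv_fbar flipped.fbar_conv_f flip: lin_iff_dual_space)
qed

text \<open>Conjugation by \<open>f\<close> and then by \<open>flipped.f\<close> applies \<open>S\<^sup>2\<close> twice.\<close>

lemma antipode_fourth_power:
  "S ^^ 4 = conv_id_conv scale \<Delta> (conv_inv scale \<Delta> \<epsilon> (conv \<Delta> f flipped.f)) (conv \<Delta> f flipped.f)"
proof (intro ext functional_separates)
  fix a h assume h: "lin h"
  let ?g = "conv \<Delta> f flipped.f" and ?k = "conv \<Delta> flipped.fbar fbar"
  define h2 h4 where "h2 = (\<lambda>x. h (S (S x)))" and "h4 = (\<lambda>x. h2 (S (S x)))"
  have h2: "lin h2"
    unfolding h2_def by (intro lin_compose[OF h] S_lins)
  have h4: "lin h4"
    unfolding h4_def by (intro lin_compose[OF h2] S_lins)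
  note lins' = h h2 h4 lin_all
  have "conv \<Delta> h ?g = conv \<Delta> (conv \<Delta> h f) flipped.f"
    by (simp add: conv_assoc lins')
  also have "\<dots> = conv \<Delta> f (conv \<Delta> h2 flipped.f)"
    unfolding conv_f_right[OF h, folded h2_def] by (simp add: conv_assoc lins')
  also have "\<dots> = conv \<Delta> ?g h4"
    unfolding flipped.conv_f_right[OF h2, folded h4_def] by (simp add: conv_assoc lins')
  finally have "conv \<Delta> ?k (conv \<Delta> h ?g) = conv \<Delta> (conv \<Delta> ?k ?g) h4"
    using conv_assoc[of ?k ?g h4] by (simp add: lins')
  also have "\<dots> = h4"
    using f_flipped_f_inverse by (simp add: is_conv_inverse_def conv_counit_left lins')
  finally have "conv \<Delta> ?k (conv \<Delta> h ?g) a = h ((S ^^ 4) a)"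
    by (simp add: h2_def h4_def numeral_eq_Suc)
  moreover have "conv_inv scale \<Delta> \<epsilon> ?g = ?k"
    by (rule conv_inv_eqI[OF _ f_flipped_f_inverse]) (simp add: lins')
  ultimately show "h ((S ^^ 4) a) = h (conv_id_conv scale \<Delta> (conv_inv scale \<Delta> \<epsilon> ?g) ?g a)"
    by (simp add: lin_conv_id_conv[OF h])
qed

end

section \<open>From universal r-forms on the tensor square to bilinear forms\<close>

context hopf_algebra begin

text \<open>A bilinear form is determined by the functional on the tensor square that it induces, and
  conversely; so invertibility can be checked on pure tensors.\<close>

lemma is_tensor_conv_inverse_iff:
  assumes P: "tensor_functional scale P"
  shows "is_tensor_conv_inverse scale \<Delta> \<epsilon> P Q \<longleftrightarrow> tensor_functional scale Q \<and>
    conv2 (\<lambda>a b. P (tensor scale a b)) (\<lambda>a b. Q (tensor scale a b)) = unit2 \<and>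
    conv2 (\<lambda>a b. Q (tensor scale a b)) (\<lambda>a b. P (tensor scale a b)) = unit2"
proof (cases "tensor_functional scale Q")
  case True
  define \<phi> where "\<phi> P Q = conv2 (\<lambda>a b. P (tensor scale a b)) (\<lambda>a b. Q (tensor scale a b))"
    for P Q :: "('a, 'k) tensor2 \<Rightarrow> 'k"
  have conv: "tensor_conv scale \<Delta> P Q T = tensor_lift (*) (\<phi> P Q) T" for P Q T
    by (simp add: tensor_conv_def \<phi>_def conv2_def[abs_def] sw_def)
  have bil: "bilin (\<phi> P Q)" "bilin (\<phi> Q P)"
    using P True by (simp_all add: \<phi>_def bilin_conv2 bilin_tensor_functional)
  have iff: "(\<forall>T\<in>tensor_space scale. tensor_lift (*) \<psi> T = tensor_lift (*) unit2 T) \<longleftrightarrow> \<psi> = unit2"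
    if "bilin \<psi>" for \<psi>
  proof
    assume eq: "\<forall>T\<in>tensor_space scale. tensor_lift (*) \<psi> T = tensor_lift (*) unit2 T"
    show "\<psi> = unit2"
    proof (intro ext)
      fix a b
      have "tensor scale a b \<in> tensor_space scale"
        by (simp add: tensor_def tensor_class_in_space)
      with eq show "\<psi> a b = unit2 a b"
        by (metis tensor_lift_tensor that bilin_unit2)
    qed
  qed simp
  have u: "(\<lambda>a b. \<epsilon> a * \<epsilon> b) = unit2"
    by (simp add: unit2_def fun_eq_iff)
  show ?thesis
    using True iff[OF bil(1)] iff[OF bil(2)]
    unfolding is_tensor_conv_inverse_def conv u \<phi>_def by blast
qed (simp add: is_tensor_conv_inverse_def)

text \<open>The inverse chosen by \<open>tensor_conv_inv\<close> is only determined on the tensor square, so it has to be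
  compared with \<open>q\<close> on pure tensors.\<close>

lemma tensor_conv_inv_tensor:
  assumes P: "tensor_functional scale P" and q: "bilin q"
    and "conv2 (\<lambda>a b. P (tensor scale a b)) q = unit2"
    and "conv2 q (\<lambda>a b. P (tensor scale a b)) = unit2"
  shows "tensor_conv_inv scale \<Delta> \<epsilon> P (tensor scale a b) = q a b"
proof -
  let ?P = "\<lambda>a b. P (tensor scale a b)"
  let ?I = "tensor_conv_inv scale \<Delta> \<epsilon> P"
  have "is_tensor_conv_inverse scale \<Delta> \<epsilon> P (tensor_lift (*) q)"
    using assms by (simp add: is_tensor_conv_inverse_iff tensor_functional_lift tensor_lift_tensor)
  then have "is_tensor_conv_inverse scale \<Delta> \<epsilon> P ?I"
    unfolding tensor_conv_inv_def by (rule someI[where P = "is_tensor_conv_inverse scale \<Delta> \<epsilon> P"])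
  then have I: "tensor_functional scale ?I" "conv2 ?P (\<lambda>a b. ?I (tensor scale a b)) = unit2"
    by (simp_all add: is_tensor_conv_inverse_iff[OF P])
  have "(\<lambda>a b. ?I (tensor scale a b)) = q"
    by (rule conv2_inverse_unique[OF bilin_tensor_functional[OF I(1)] bilin_tensor_functional[OF P] q])
       (use assms I in simp_all)
  then show ?thesis by meson
qed

lemma universal_r_form_imp_hopf_r_form:
  assumes "universal_r_form scale \<Delta> \<epsilon> r"
  shows "tensor_functional scale (tensor_conv_inv scale \<Delta> \<epsilon> r)"
    and "hopf_r_form scale \<Delta> \<epsilon> S (\<lambda>a b. r (tensor scale a b))
      (\<lambda>a b. tensor_conv_inv scale \<Delta> \<epsilon> r (tensor scale a b))"
proof -
  let ?I = "tensor_conv_inv scale \<Delta> \<epsilon> r"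
  have r: "tensor_functional scale r"
    using assms by (simp add: universal_r_form_def)
  have "is_tensor_conv_inverse scale \<Delta> \<epsilon> r ?I"
    using assms unfolding universal_r_form_def tensor_conv_inv_def by (metis someI_ex)
  then have I: "tensor_functional scale ?I"
    and inv: "conv2 (\<lambda>a b. r (tensor scale a b)) (\<lambda>a b. ?I (tensor scale a b)) = unit2"
      "conv2 (\<lambda>a b. ?I (tensor scale a b)) (\<lambda>a b. r (tensor scale a b)) = unit2"
    by (simp_all add: is_tensor_conv_inverse_iff[OF r])
  show "tensor_functional scale ?I" by (rule I)
  show "hopf_r_form scale \<Delta> \<epsilon> S (\<lambda>a b. r (tensor scale a b)) (\<lambda>a b. ?I (tensor scale a b))"
  proof unfold_locales
    show "bilin (\<lambda>a b. r (tensor scale a b))" "bilin (\<lambda>a b. ?I (tensor scale a b))"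
      using r I by (simp_all add: bilin_tensor_functional)
  next
    fix a b c
    show "r (tensor scale c (a * b)) = sw c (\<lambda>x y. r (tensor scale x b) * r (tensor scale y a))"
      and "r (tensor scale (a * b) c) = sw c (\<lambda>x y. r (tensor scale a x) * r (tensor scale b y))"
      using assms unfolding universal_r_form_def sw_def by blast+
  next
    fix h a b assume h: "lin h"
    have "h (tensor_lift scale (\<lambda>a1 a2. tensor_lift scale (\<lambda>b1 b2.
            scale (r (tensor scale a1 b1)) (a2 * b2)) (\<Delta> b)) (\<Delta> a)) =
        h (tensor_lift scale (\<lambda>a1 a2. tensor_lift scale (\<lambda>b1 b2.
            scale (r (tensor scale a2 b2)) (b1 * a1)) (\<Delta> b)) (\<Delta> a))"
      using assms unfolding universal_r_form_def by (intro arg_cong[where f = h]) blast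
    then show "sw a (\<lambda>x y. sw b (\<lambda>u v. r (tensor scale x u) * h (y * v))) =
        sw a (\<lambda>x y. sw b (\<lambda>u v. r (tensor scale y v) * h (u * x)))"
      using h by (simp add: lin_tensor_lift[OF h] lin_def sw_def)
  qed (fact inv)+
qed

lemma second_r_form_eq_lift:
  assumes I: "tensor_functional scale (tensor_conv_inv scale \<Delta> \<epsilon> r)"
  shows "second_r_form scale \<Delta> \<epsilon> r =
    tensor_lift (*) (\<lambda>a b. tensor_conv_inv scale \<Delta> \<epsilon> r (tensor scale b a))"
proof
  fix T
  show "second_r_form scale \<Delta> \<epsilon> r T =
      tensor_lift (*) (\<lambda>a b. tensor_conv_inv scale \<Delta> \<epsilon> r (tensor scale b a)) T"
    unfolding second_r_form_def
    by (subst tensor_functional_eq_lift[OF I tensor_flip_in_space])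
       (rule tensor_lift_flip[OF bilin_tensor_functional[OF I]])
qed

end

theorem proposition4p3:
  fixes scale :: "'k::field \<Rightarrow> 'a::ring_1 \<Rightarrow> 'a"
    and \<Delta> :: "'a \<Rightarrow> ('a, 'k) tensor2"
    and \<epsilon> :: "'a \<Rightarrow> 'k"
    and S :: "'a \<Rightarrow> 'a"
    and r :: "('a, 'k) tensor2 \<Rightarrow> 'k"
  assumes "coquasitriangular_hopf_algebra scale \<Delta> \<epsilon> S r"
  shows "let s = second_r_form scale \<Delta> \<epsilon> r;
             f\<^sub>r = f_form scale \<Delta> S r;
             fbar\<^sub>r = fbar_form scale \<Delta> \<epsilon> S r;
             f\<^sub>s = f_form scale \<Delta> S s;
             fbar\<^sub>s = fbar_form scale \<Delta> \<epsilon> S s;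
             z = conv \<Delta> f\<^sub>r fbar\<^sub>s;
             g = conv \<Delta> f\<^sub>r f\<^sub>s
         in (\<forall>f\<in>{f\<^sub>r, fbar\<^sub>r, f\<^sub>s, fbar\<^sub>s}. \<forall>h\<in>{f\<^sub>r, fbar\<^sub>r, f\<^sub>s, fbar\<^sub>s}.
               f \<in> dual_space scale \<and> conv \<Delta> f h = conv \<Delta> h f) \<and>
            z \<in> dual_center scale \<Delta> \<and>
            is_character scale g \<and>
            (\<exists>h. is_conv_inverse scale \<Delta> \<epsilon> g h) \<and>
            S ^^ 4 = conv_id_conv scale \<Delta> (conv_inv scale \<Delta> \<epsilon> g) g"
proof -
  interpret coquasitriangular_hopf_algebra scale \<Delta> \<epsilon> S r by (rule assms)
  let ?s = "second_r_form scale \<Delta> \<epsilon> r"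
  define p q where "p a b = r (tensor scale a b)"
    and "q a b = tensor_conv_inv scale \<Delta> \<epsilon> r (tensor scale a b)" for a b
  have R: "hopf_r_form scale \<Delta> \<epsilon> S p q"
    using universal_r_form_imp_hopf_r_form(2)[OF r_form] by (simp add: p_def[abs_def] q_def[abs_def])
  interpret F: hopf_r_form_flipped scale \<Delta> \<epsilon> S p q
    by (intro hopf_r_form_flipped.intro R hopf_r_form.flipped_inverse_r_form)
  have s_lift: "?s = tensor_lift (*) (\<lambda>a b. q b a)"
    unfolding q_def by (rule second_r_form_eq_lift[OF universal_r_form_imp_hopf_r_form(1)[OF r_form]])
  have s: "?s (tensor scale a b) = q b a" for a b
    unfolding s_lift by (rule tensor_lift_tensor[OF F.flipped.bilin_p])
  have s_inv: "tensor_conv_inv scale \<Delta> \<epsilon> ?s (tensor scale a b) = p b a" for a b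
  proof (rule tensor_conv_inv_tensor)
    show "tensor_functional scale ?s"
      unfolding s_lift by (rule tensor_functional_lift[OF F.flipped.bilin_p])
  qed (simp_all add: s F.flipped.bilin_q F.flipped.conv2_p_q F.flipped.conv2_q_p)
  have eqs: "f_form scale \<Delta> S r = F.f" "fbar_form scale \<Delta> \<epsilon> S r = F.fbar"
    "f_form scale \<Delta> S ?s = F.flipped.f" "fbar_form scale \<Delta> \<epsilon> S ?s = F.flipped.fbar"
    by (simp_all add: fun_eq_iff f_form_def fbar_form_def sw_def F.f_def F.fbar_def F.flipped.f_def
        F.flipped.fbar_def s s_inv flip: p_def q_def)
  have "conv \<Delta> F.f F.flipped.fbar \<in> dual_center scale \<Delta>"
    using F.f_flipped_fbar_central F.lin_all
    by (simp add: dual_center_def flip: lin_iff_dual_space)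
  moreover have "is_character scale (conv \<Delta> F.f F.flipped.f)"
    using F.f_flipped_f_mult F.lin_all by (simp add: is_character_def flip: lin_iff_dual_space)
  moreover have "h \<in> dual_space scale" if "h \<in> {F.f, F.fbar, F.flipped.f, F.flipped.fbar}" for h
    using that F.lin_all by (auto simp flip: lin_iff_dual_space)
  ultimately show ?thesis
    unfolding Let_def eqs
    using F.functionals_commute F.f_flipped_f_inverse F.antipode_fourth_power by blast
qed

end
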